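(* Let $D$ be a finite distributive lattice whose unit (greatest) element is join-irreducible, and let $Q \subseteq D$. Then $Q$ is principal congruence representable if and only if $Q$ is chain representable.
   Context: For a finite lattice $L$, $\operatorname{Con} L$ denotes the congruence lattice of $L$. For $x, y \in L$, $\operatorname{con}(x,y)$ denotes the smallest congruence of $L$ identifying $x$ and $y$; congruences of this form are called principal, and $\operatorname{Princ} L \subseteq \operatorname{Con} L$ denotes the set of all principal congruences of $L$ (this includes the zero congruence $\operatorname{con}(x,x)$). For a finite distributive lattice $D$, a subset $Q \subseteq D$ is called principal congruence representable (briefly, representable) if there exist a finite lattice $L$ and a lattice isomorphism $\varphi \colon D \to \operatorname{Con} L$ such that $\varphi(Q) = \operatorname{Princ} L$. $\operatorname{J}(D)$ denotes the ordered set of (nonzero) join-irreducible elements of $D$; the unit of $D$ being join-irreducible means that the greatest element of $D$ belongs to $\operatorname{J}(D)$. For a finite chain $C$, $\operatorname{Prime} C$ denotes the set of prime intervals of $C$, that is, intervals $[x,y]$ of $C$ in which $y$ covers $x$. The chain $C$ is colored by an ordered set $P$ if there is given a map $\operatorname{col}$ of $\operatorname{Prime} C$ onto $P$ (surjective; no other condition is imposed). For $x \le y$ in $C$, the color set of $[x,y]$ is $$\operatorname{colSet}[x,y] = \{\operatorname{col}(\mathfrak p) \mid \mathfrak p \text{ is a prime interval of } C \text{ contained in } [x,y]\};$$ in particular $\operatorname{colSet}[x,x] = \varnothing$. If $C$ is a finite chain colored by $P = \operatorname{J}(D)$, define $\operatorname{Rep}[x,y] = \bigvee \operatorname{colSet}[x,y]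 \in D$ for $x \le y$ in $C$ (join formed in $D$, the empty join being the zero of $D$), and $$\operatorname{Rep} C = \{\operatorname{Rep}[x,y] \mid x \le y \text{ in } C\} \subseteq D.$$ A subset $Q \subseteq D$ is called (colored-)chain representable if there is a finite (nonempty) chain $C$ colored by $\operatorname{J}(D)$ such that $Q = \operatorname{Rep} C$. *)

theory Defs
  imports "HOL-Algebra.Lattice"
begin

locale finite_nonempty_lattice = lattice L for L (structure) +
  assumes finite_carrier: "finite (carrier L)"
    and carrier_nonempty: "carrier L \<noteq> {}"

locale finite_distributive_lattice = finite_nonempty_lattice D for D (structure) +
  assumes meet_join_distrib:
    "\<lbrakk>x \<in> carrier D; y \<in> carrier D; z \<in> carrier D\<rbrakk>
      \<Longrightarrow> x \<sqinter> (y \<squnion> z) = (x \<sqinter> y) \<squnion> (x \<sqinter> z)"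

definition lattice_isomorphism ::
    "('a, 'c) gorder_scheme \<Rightarrow> ('b, 'd) gorder_scheme \<Rightarrow> ('a \<Rightarrow> 'b) \<Rightarrow> bool" where
  "lattice_isomorphism A B f \<longleftrightarrow>
    bij_betw f (carrier A) (carrier B) \<and> join_pres A B f \<and> meet_pres A B f"

definition join_irreducibles :: "('a, 'c) gorder_scheme \<Rightarrow> 'a set" where
  "join_irreducibles D =
    {j \<in> carrier D. j \<noteq> \<bottom>\<^bsub>D\<^esub> \<and>
      (\<forall>x\<in>carrier D. \<forall>y\<in>carrier D. j = x \<squnion>\<^bsub>D\<^esub> y \<longrightarrow> j = x \<or> j = y)}"

subsection \<open>Congruences\<close>

definition lattice_congruence :: "('a, 'c) gorder_scheme \<Rightarrow> ('a \<times> 'a) set \<Rightarrow> bool" where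
  "lattice_congruence L \<theta> \<longleftrightarrow> equiv (carrier L) \<theta> \<and>
    (\<forall>a b c d. (a, b) \<in> \<theta> \<and> (c, d) \<in> \<theta> \<longrightarrow>
      (a \<squnion>\<^bsub>L\<^esub> c, b \<squnion>\<^bsub>L\<^esub> d) \<in> \<theta> \<and> (a \<sqinter>\<^bsub>L\<^esub> c, b \<sqinter>\<^bsub>L\<^esub> d) \<in> \<theta>)"

definition Con :: "('a, 'c) gorder_scheme \<Rightarrow> ('a \<times> 'a) set gorder" where
  "Con L = \<lparr>carrier = {\<theta>. lattice_congruence L \<theta>}, eq = (=), le = (\<subseteq>)\<rparr>"

definition con :: "('a, 'c) gorder_scheme \<Rightarrow> 'a \<Rightarrow> 'a \<Rightarrow> ('a \<times> 'a) set" where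
  "con L x y = \<Inter>{\<theta>. lattice_congruence L \<theta> \<and> (x, y) \<in> \<theta>}"

definition Princ :: "('a, 'c) gorder_scheme \<Rightarrow> ('a \<times> 'a) set set" where
  "Princ L = {con L x y | x y. x \<in> carrier L \<and> y \<in> carrier L}"

lemma (in lattice) lattice_congruence_Times: "lattice_congruence L (carrier L \<times> carrier L)"
  by (auto simp: lattice_congruence_def intro!: equivI refl_onI symI transI)

lemma (in lattice) con_least:
  assumes "x \<in> carrier L" and "y \<in> carrier L"
  shows "least (Con L) (con L x y) {\<theta> \<in> carrier (Con L). (x, y) \<in> \<theta>}"
proof -
  let ?S = "{\<theta>. lattice_congruence L \<theta> \<and> (x, y) \<in> \<theta>}"
  have top: "carrier L \<times> carrier L \<in> ?S"
    using assms lattice_congruence_Times by simp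
  have mem: "p \<in> con L x y \<longleftrightarrow> (\<forall>\<theta>\<in>?S. p \<in> \<theta>)" for p
    by (simp add: con_def)
  have S: "equiv (carrier L) \<theta>" if "\<theta> \<in> ?S" for \<theta>
    using that by (simp add: lattice_congruence_def)
  have "equiv (carrier L) (con L x y)"
  proof (rule equivI)
    show "con L x y \<subseteq> carrier L \<times> carrier L"
      unfolding con_def using top by (rule Inter_lower)
    show "refl_on (carrier L) (con L x y)"
      unfolding refl_on_def mem using S by (meson equivE refl_onD)
    show "sym (con L x y)"
      unfolding sym_def mem using S by (meson equivE symD)
    show "trans (con L x y)"
      unfolding trans_def mem using S by (meson equivE transD)
  qed
  moreover have "(a \<squnion> c, b \<squnion> d) \<in> con L x y \<and> (a \<sqinter> c, b \<sqinter> d) \<in> con L x y"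
    if "(a, b) \<in> con L x y" "(c, d) \<in> con L x y" for a b c d
    using that unfolding mem by (simp add: lattice_congruence_def)
  ultimately have "lattice_congruence L (con L x y)"
    unfolding lattice_congruence_def by blast
  then show ?thesis
    unfolding least_def Con_def by (simp add: con_def) blast
qed

text \<open>
  The lattice \<open>L\<close> below has its carrier in \<open>nat\<close>, since a type cannot be quantified
  existentially; this is no restriction, as every finite lattice is isomorphic to such an \<open>L\<close>.
  The same remark applies to the finite chain in \<open>chain_representable\<close>.
\<close>

definition principal_congruence_representable :: "('a, 'c) gorder_scheme \<Rightarrow> 'a set \<Rightarrow> bool" where
  "principal_congruence_representable D Q \<longleftrightarrow>
    (\<exists>(L :: nat gorder) \<phi>. finite_nonempty_lattice L \<and>
      lattice_isomorphism D (Con L) \<phi> \<and> \<phi> ` Q = Princ L)"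

subsection \<open>Colored chains\<close>

locale finite_chain = total_order C for C (structure) +
  assumes finite_carrier: "finite (carrier C)"
    and carrier_nonempty: "carrier C \<noteq> {}"

text \<open>A prime interval \<open>[x, y]\<close> is encoded as the pair of its endpoints.\<close>

definition Prime :: "('a, 'c) gorder_scheme \<Rightarrow> ('a \<times> 'a) set" where
  "Prime C = {(x, y). x \<in> carrier C \<and> y \<in> carrier C \<and> x \<sqsubset>\<^bsub>C\<^esub> y \<and>
    \<not> (\<exists>z\<in>carrier C. x \<sqsubset>\<^bsub>C\<^esub> z \<and> z \<sqsubset>\<^bsub>C\<^esub> y)}"

definition coloring :: "('a, 'c) gorder_scheme \<Rightarrow> 'b set \<Rightarrow> ('a \<times> 'a \<Rightarrow> 'b) \<Rightarrow> bool" where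
  "coloring C P col \<longleftrightarrow> col ` Prime C = P"

definition colSet ::
    "('a, 'c) gorder_scheme \<Rightarrow> ('a \<times> 'a \<Rightarrow> 'b) \<Rightarrow> 'a \<Rightarrow> 'a \<Rightarrow> 'b set" where
  "colSet C col x y =
    {col (u, v) | u v. (u, v) \<in> Prime C \<and> \<lbrace>u..v\<rbrace>\<^bsub>C\<^esub> \<subseteq> \<lbrace>x..y\<rbrace>\<^bsub>C\<^esub>}"

definition Rep_interval ::
    "('b, 'd) gorder_scheme \<Rightarrow> ('a, 'c) gorder_scheme \<Rightarrow> ('a \<times> 'a \<Rightarrow> 'b) \<Rightarrow> 'a \<Rightarrow> 'a \<Rightarrow> 'b" where
  "Rep_interval D C col x y = \<Squnion>\<^bsub>D\<^esub> (colSet C col x y)"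

definition Rep ::
    "('b, 'd) gorder_scheme \<Rightarrow> ('a, 'c) gorder_scheme \<Rightarrow> ('a \<times> 'a \<Rightarrow> 'b) \<Rightarrow> 'b set" where
  "Rep D C col =
    {Rep_interval D C col x y | x y. x \<in> carrier C \<and> y \<in> carrier C \<and> x \<sqsubseteq>\<^bsub>C\<^esub> y}"

definition chain_representable :: "('a, 'c) gorder_scheme \<Rightarrow> 'a set \<Rightarrow> bool" where
  "chain_representable D Q \<longleftrightarrow>
    (\<exists>(C :: nat gorder) col. finite_chain C \<and>
      coloring C (join_irreducibles D) col \<and> Q = Rep D C col)"

end

theory Submission
  imports Defs "HOL-Algebra.Complete_Lattice" "HOL-Library.Sublist"
begin

text \<open>
  A colored chain is treated as the word of its colors; intervals are then the contiguous subwords.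
  From a lattice \<open>L\<close> representing \<open>D\<close>, one gets a word by concatenating, for all pairs
  \<open>x \<le> y\<close>, the colors of a maximal chain of \<open>[x, y]\<close>, each followed by the unit: a contiguous
  subword contains the unit or lies on one of the maximal chains.

  Conversely, a word is turned into a lattice made of finite chains (blocks) between \<open>0\<close> and \<open>1\<close>,
  ordered along a bipartite graph without 4-cycles. One block carries the word. A prime interval
  inside it cannot be made projective to something outside directly, since everything below it
  would have to be transported along. Hence for each \<open>i\<close> a copy of the initial segment of length
  \<open>i\<close> is put below; its last prime interval is free to move up, and there it is linked with an
  interval that depends only on the color. These intervals are linked by pentagons according to
  the order of the colors. Identifying two comparable elements of different blocks collapses
  everything, so the principal congruences come from intervals of single blocks.
\<close>

text \<open>The join-irreducible unit is what lets the blocks share their bounds. The full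
  congruence, generated by the bounds, is always principal, so the word has to account for it: the
  unit is a letter, hence the join of a one-letter subword. Moreover, the congruences that stay
  within the blocks correspond to down-sets of colors without the unit. Such a down-set has a join
  different from the unit because the unit, being join-irreducible in a distributive lattice, is
  join-prime; so no other congruence competes with the full one. In the opposite direction the unit
  can serve as separator because it is the color of a prime interval of the given lattice: it
  belongs to \<open>Q\<close>, and every subword that leaves one maximal chain has it as its join.
  Both directions rest on one equivalence: an element of \<open>D\<close> bounds the colors along a
  maximal chain iff its congruence identifies the endpoints.\<close>

sublocale finite_nonempty_lattice \<subseteq> complete_lattice
proof -
  have c: "\<exists>s. is_lub L s A" if "A \<subseteq> carrier L" "A \<noteq> {}" for A
    using finite_sup_least[of A] that finite_carrier finite_subset by metis
  have d: "\<exists>s. is_glb L s A" if "A \<subseteq> carrier L" "A \<noteq> {}" for A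
    using finite_inf_greatest[of A] that finite_carrier finite_subset by metis
  have g: "\<exists>g. greatest L g (carrier L)"
    using c[OF subset_refl carrier_nonempty] by (auto simp: greatest_def least_def Upper_def)
  show "complete_lattice L"
    by (rule complete_lattice_criterion1) (use g d in auto)
qed

subsection \<open>Isomorphisms\<close>

lemma lattice_isomorphism_le_iff:
  assumes "lattice_isomorphism A B f" "x \<in> carrier A" "y \<in> carrier A"
  shows "f x \<sqsubseteq>\<^bsub>B\<^esub> f y \<longleftrightarrow> x \<sqsubseteq>\<^bsub>A\<^esub> y"
proof -
  have AB: "lattice A" "lattice B" and bij: "bij_betw f (carrier A) (carrier B)"
    and join: "f (x \<squnion>\<^bsub>A\<^esub> y) = f x \<squnion>\<^bsub>B\<^esub> f y"
    using assms by (auto simp: lattice_isomorphism_def join_pres_def)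
  interpret A: lattice A by (rule AB)
  interpret B: lattice B by (rule AB)
  have "f x \<in> carrier B" "f y \<in> carrier B"
    using bij assms by (auto simp: bij_betw_def)
  then have "f x \<sqsubseteq>\<^bsub>B\<^esub> f y \<longleftrightarrow> f (x \<squnion>\<^bsub>A\<^esub> y) = f y"
    by (simp add: B.le_iff_meet join)
  also have "\<dots> \<longleftrightarrow> x \<squnion>\<^bsub>A\<^esub> y = y"
    using bij assms by (auto simp: bij_betw_def inj_on_eq_iff)
  finally show ?thesis
    using assms by (simp add: A.le_iff_meet)
qed

lemma is_lub_image:
  assumes bij: "bij_betw f (carrier A) (carrier B)"
    and le: "\<And>x y. x \<in> carrier A \<Longrightarrow> y \<in> carrier A \<Longrightarrow> f x \<sqsubseteq>\<^bsub>B\<^esub> f y \<longleftrightarrow> x \<sqsubseteq>\<^bsub>A\<^esub> y"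
    and "X \<subseteq> carrier A" "is_lub A s X"
  shows "is_lub B (f s) (f ` X)"
proof (rule least_UpperI)
  have s: "s \<in> carrier A" using assms(4) by auto
  then show "f s \<in> carrier B" using bij by (auto simp: bij_betw_def)
  show fX: "f ` X \<subseteq> carrier B" using bij assms(3) by (auto simp: bij_betw_def)
  show "x \<sqsubseteq>\<^bsub>B\<^esub> f s" if "x \<in> f ` X" for x
    using that assms(3) s by (auto simp: le subset_iff intro!: least_Upper_above[OF assms(4)])
  show "f s \<sqsubseteq>\<^bsub>B\<^esub> y" if "y \<in> Upper B (f ` X)" for y
  proof -
    have "y \<in> carrier B" using that by (auto simp: Upper_def)
    then obtain z where z: "z \<in> carrier A" "y = f z" using bij by (auto simp: bij_betw_def)
    have "z \<in> Upper A X"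
    proof (rule Upper_memI[OF _ z(1)])
      fix x assume x: "x \<in> X"
      then have "f x \<sqsubseteq>\<^bsub>B\<^esub> f z"
        using Upper_memD[OF that _ fX, of "f x"] z by auto
      then show "x \<sqsubseteq>\<^bsub>A\<^esub> z" using le x z assms(3) by blast
    qed
    then show ?thesis
      using assms(4) z s by (simp add: le least_def)
  qed
qed

lemma is_glb_image:
  assumes bij: "bij_betw f (carrier A) (carrier B)"
    and le: "\<And>x y. x \<in> carrier A \<Longrightarrow> y \<in> carrier A \<Longrightarrow> f x \<sqsubseteq>\<^bsub>B\<^esub> f y \<longleftrightarrow> x \<sqsubseteq>\<^bsub>A\<^esub> y"
    and "X \<subseteq> carrier A" "is_glb A s X"
  shows "is_glb B (f s) (f ` X)"
  using is_lub_image[of f "inv_gorder A" "inv_gorder B" X s] assms by simp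

text \<open>\<open>B\<close> is only assumed to be ordered: the existence of bounds in it is itself
  transported along \<open>f\<close>. In this way \<open>Con L\<close> becomes a lattice without any
  description of joins of congruences.\<close>

lemma order_isomorphism_imp_lattice_isomorphism:
  assumes "lattice A" "partial_order B"
    and bij: "bij_betw f (carrier A) (carrier B)"
    and le: "\<And>x y. x \<in> carrier A \<Longrightarrow> y \<in> carrier A \<Longrightarrow> f x \<sqsubseteq>\<^bsub>B\<^esub> f y \<longleftrightarrow> x \<sqsubseteq>\<^bsub>A\<^esub> y"
  shows "lattice_isomorphism A B f"
proof -
  interpret A: lattice A by fact
  interpret B: partial_order B by fact
  have lub: "is_lub B (f (x \<squnion>\<^bsub>A\<^esub> y)) {f x, f y}"
    if "x \<in> carrier A" "y \<in> carrier A" for x y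
    using is_lub_image[OF bij le, of "{x, y}"] that A.sup_of_two_least[OF that]
    by (simp add: join_def)
  have glb: "is_glb B (f (x \<sqinter>\<^bsub>A\<^esub> y)) {f x, f y}"
    if "x \<in> carrier A" "y \<in> carrier A" for x y
    using is_glb_image[OF bij le, of "{x, y}"] that A.inf_of_two_greatest[OF that]
    by (simp add: meet_def)
  have car: "carrier B = f ` carrier A" using bij by (auto simp: bij_betw_def)
  interpret B: lattice B
    by unfold_locales (use lub glb car in \<open>auto, blast+\<close>)
  have "f (x \<squnion>\<^bsub>A\<^esub> y) = f x \<squnion>\<^bsub>B\<^esub> f y" if "x \<in> carrier A" "y \<in> carrier A" for x y
    using B.least_unique[OF lub[OF that]] B.sup_of_two_least[of "f x" "f y"] that car
    by (auto simp: join_def)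
  moreover have "f (x \<sqinter>\<^bsub>A\<^esub> y) = f x \<sqinter>\<^bsub>B\<^esub> f y" if "x \<in> carrier A" "y \<in> carrier A" for x y
    using B.greatest_unique[OF glb[OF that]] B.inf_of_two_greatest[of "f x" "f y"] that car
    by (auto simp: meet_def)
  ultimately show ?thesis
    unfolding lattice_isomorphism_def join_pres_def meet_pres_def
    using bij A.lattice_axioms B.lattice_axioms by blast
qed

subsection \<open>Congruences\<close>

lemma partial_order_Con: "partial_order (Con L)"
  by unfold_locales (auto simp: Con_def)

lemma carrier_Con [simp]: "\<theta> \<in> carrier (Con L) \<longleftrightarrow> lattice_congruence L \<theta>"
  by (simp add: Con_def)

lemma le_Con [simp]: "\<alpha> \<sqsubseteq>\<^bsub>Con L\<^esub> \<beta> \<longleftrightarrow> \<alpha> \<subseteq> \<beta>"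
  by (simp add: Con_def)

lemma lattice_congruenceD:
  assumes "lattice_congruence L \<theta>"
  shows "equiv (carrier L) \<theta>" "\<theta> \<subseteq> carrier L \<times> carrier L"
    "\<And>x. x \<in> carrier L \<Longrightarrow> (x, x) \<in> \<theta>"
    "\<And>x y. (x, y) \<in> \<theta> \<Longrightarrow> (y, x) \<in> \<theta>"
    "\<And>x y z. (x, y) \<in> \<theta> \<Longrightarrow> (y, z) \<in> \<theta> \<Longrightarrow> (x, z) \<in> \<theta>"
    "\<And>a b c d. (a, b) \<in> \<theta> \<Longrightarrow> (c, d) \<in> \<theta> \<Longrightarrow> (a \<squnion>\<^bsub>L\<^esub> c, b \<squnion>\<^bsub>L\<^esub> d) \<in> \<theta>"
    "\<And>a b c d. (a, b) \<in> \<theta> \<Longrightarrow> (c, d) \<in> \<theta> \<Longrightarrow> (a \<sqinter>\<^bsub>L\<^esub> c, b \<sqinter>\<^bsub>L\<^esub> d) \<in> \<theta>"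
proof -
  show e: "equiv (carrier L) \<theta>" using assms by (simp add: lattice_congruence_def)
  show s: "\<theta> \<subseteq> carrier L \<times> carrier L" using e by (rule equiv_type)
  show "\<And>x. x \<in> carrier L \<Longrightarrow> (x, x) \<in> \<theta>" using e by (meson equivE refl_onD)
  show "\<And>x y. (x, y) \<in> \<theta> \<Longrightarrow> (y, x) \<in> \<theta>" using e by (meson equivE symD)
  show "\<And>x y z. (x, y) \<in> \<theta> \<Longrightarrow> (y, z) \<in> \<theta> \<Longrightarrow> (x, z) \<in> \<theta>" using e by (meson equivE transD)
  show "\<And>a b c d. (a, b) \<in> \<theta> \<Longrightarrow> (c, d) \<in> \<theta> \<Longrightarrow> (a \<squnion>\<^bsub>L\<^esub> c, b \<squnion>\<^bsub>L\<^esub> d) \<in> \<theta>"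
    "\<And>a b c d. (a, b) \<in> \<theta> \<Longrightarrow> (c, d) \<in> \<theta> \<Longrightarrow> (a \<sqinter>\<^bsub>L\<^esub> c, b \<sqinter>\<^bsub>L\<^esub> d) \<in> \<theta>"
    using assms by (simp_all add: lattice_congruence_def)
qed

context lattice
begin

lemma join_absorb: "x \<in> carrier L \<Longrightarrow> y \<in> carrier L \<Longrightarrow> x \<sqsubseteq> y \<Longrightarrow> x \<squnion> y = y"
  by (simp add: le_iff_meet)

lemma join_absorb2: "x \<in> carrier L \<Longrightarrow> y \<in> carrier L \<Longrightarrow> x \<sqsubseteq> y \<Longrightarrow> y \<squnion> x = y"
  using join_absorb join_comm by metis

lemma meet_absorb: "x \<in> carrier L \<Longrightarrow> y \<in> carrier L \<Longrightarrow> x \<sqsubseteq> y \<Longrightarrow> x \<sqinter> y = x"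
  using le_iff_join by metis

lemma meet_absorb2: "x \<in> carrier L \<Longrightarrow> y \<in> carrier L \<Longrightarrow> x \<sqsubseteq> y \<Longrightarrow> y \<sqinter> x = x"
  using meet_absorb meet_comm by metis

lemma congruence_convex:
  assumes "lattice_congruence L \<theta>" "(x, z) \<in> \<theta>" "x \<sqsubseteq> y" "y \<sqsubseteq> z" "y \<in> carrier L"
  shows "(x, y) \<in> \<theta>" "(y, z) \<in> \<theta>"
proof -
  note \<theta> = lattice_congruenceD[OF assms(1)]
  have c: "x \<in> carrier L" "z \<in> carrier L" using \<theta>(2) assms by auto
  have "(x \<squnion> y, z \<squnion> y) \<in> \<theta>" using \<theta>(3,6) assms by blast
  then show "(y, z) \<in> \<theta>" using assms c by (simp add: join_absorb join_absorb2)
  then show "(x, y) \<in> \<theta>" using \<theta>(4,5) assms(2) by blast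
qed

text \<open>Reduces every question about a pair to the interval between its meet and its join, so
  that only comparable pairs have to be examined. From left to right, convexity puts both elements
  into the class of the meet.\<close>

lemma congruence_meet_join_iff:
  assumes "lattice_congruence L \<theta>" "x \<in> carrier L" "y \<in> carrier L"
  shows "(x \<sqinter> y, x \<squnion> y) \<in> \<theta> \<longleftrightarrow> (x, y) \<in> \<theta>"
proof
  note \<theta> = lattice_congruenceD[OF assms(1)]
  assume "(x \<sqinter> y, x \<squnion> y) \<in> \<theta>"
  then have "(x \<sqinter> y, x) \<in> \<theta>" "(x \<sqinter> y, y) \<in> \<theta>"
    using assms congruence_convex(1)[OF assms(1)]
    by (meson join_left join_right meet_left meet_right)+
  then show "(x, y) \<in> \<theta>" using \<theta>(4,5) by blast
next
  note \<theta> = lattice_congruenceD[OF assms(1)]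
  assume xy: "(x, y) \<in> \<theta>"
  have "(x \<sqinter> y, y \<sqinter> y) \<in> \<theta>" "(x \<squnion> y, y \<squnion> y) \<in> \<theta>"
    using \<theta>(3,6,7) xy assms by blast+
  then show "(x \<sqinter> y, x \<squnion> y) \<in> \<theta>"
    using assms \<theta>(4,5) by (metis join_absorb meet_absorb le_refl)
qed

lemma con_congruence:
  assumes "x \<in> carrier L" "y \<in> carrier L"
  shows "lattice_congruence L (con L x y)" "(x, y) \<in> con L x y"
  using con_least[OF assms] by (simp_all add: least_def Con_def)

lemma con_subset_iff:
  assumes "x \<in> carrier L" "y \<in> carrier L" "lattice_congruence L \<theta>"
  shows "con L x y \<subseteq> \<theta> \<longleftrightarrow> (x, y) \<in> \<theta>"
  using con_congruence(2)[OF assms(1,2)] assms(3) by (auto simp: con_def)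

lemma con_meet_join:
  assumes "x \<in> carrier L" "y \<in> carrier L"
  shows "con L (x \<sqinter> y) (x \<squnion> y) = con L x y"
  unfolding con_def using congruence_meet_join_iff[OF _ assms] by metis

lemma Princ_eq: "Princ L = {con L x y |x y. x \<in> carrier L \<and> y \<in> carrier L \<and> x \<sqsubseteq> y}"
proof -
  have "\<exists>x' y'. con L x y = con L x' y' \<and> x' \<in> carrier L \<and> y' \<in> carrier L \<and> x' \<sqsubseteq> y'"
    if "x \<in> carrier L" "y \<in> carrier L" for x y
    using that con_meet_join[OF that]
    by (metis join_closed join_left le_trans meet_closed meet_left)
  then show ?thesis unfolding Princ_def by blast
qed

lemma congruence_of_translations:
  assumes equiv: "equiv (carrier L) \<theta>"
    and join: "\<And>x y z. (x, y) \<in> \<theta> \<Longrightarrow> z \<in> carrier L \<Longrightarrow> (x \<squnion> z, y \<squnion> z) \<in> \<theta>"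
    and meet: "\<And>x y z. (x, y) \<in> \<theta> \<Longrightarrow> z \<in> carrier L \<Longrightarrow> (x \<sqinter> z, y \<sqinter> z) \<in> \<theta>"
  shows "lattice_congruence L \<theta>"
  unfolding lattice_congruence_def
proof (intro conjI allI impI equiv)
  fix a b c d assume *: "(a, b) \<in> \<theta> \<and> (c, d) \<in> \<theta>"
  then have c: "{a, b, c, d} \<subseteq> carrier L" using equiv_type[OF equiv] by auto
  have trans: "trans \<theta>" using equiv by (rule equivE)
  have "(a \<squnion> c, b \<squnion> c) \<in> \<theta>" "(c \<squnion> b, d \<squnion> b) \<in> \<theta>"
    using * c join by blast+
  then show "(a \<squnion> c, b \<squnion> d) \<in> \<theta>"
    using transD[OF trans] unfolding join_comm[of L c b] join_comm[of L d b] by blast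
  have "(a \<sqinter> c, b \<sqinter> c) \<in> \<theta>" "(c \<sqinter> b, d \<sqinter> b) \<in> \<theta>"
    using * c meet by blast+
  then show "(a \<sqinter> c, b \<sqinter> d) \<in> \<theta>"
    using transD[OF trans] unfolding meet_comm[of L c b] meet_comm[of L d b] by blast
qed

text \<open>This is the join of \<open>\<alpha>\<close> and \<open>\<beta>\<close> in
  \<open>Con L\<close>: reflexivity and symmetry are inherited, and a translation maps a path of
  steps to a path of steps.\<close>

lemma congruence_of_trancl:
  assumes "lattice_congruence L \<alpha>" "lattice_congruence L \<beta>"
  shows "lattice_congruence L ((\<alpha> \<union> \<beta>)\<^sup>+)"
proof (rule congruence_of_translations)
  note a = lattice_congruenceD[OF assms(1)] and b = lattice_congruenceD[OF assms(2)]
  show "equiv (carrier L) ((\<alpha> \<union> \<beta>)\<^sup>+)"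
  proof (rule equivI)
    show "(\<alpha> \<union> \<beta>)\<^sup>+ \<subseteq> carrier L \<times> carrier L"
      by (rule trancl_subset_Sigma) (use a(2) b(2) in blast)
    show "refl_on (carrier L) ((\<alpha> \<union> \<beta>)\<^sup>+)" unfolding refl_on_def using a(3) by blast
    have "sym (\<alpha> \<union> \<beta>)" unfolding sym_def using a(4) b(4) by blast
    then show "sym ((\<alpha> \<union> \<beta>)\<^sup>+)" by (rule sym_trancl)
  qed simp
  fix x y z assume "(x, y) \<in> (\<alpha> \<union> \<beta>)\<^sup>+" and z: "z \<in> carrier L"
  then show "(x \<squnion> z, y \<squnion> z) \<in> (\<alpha> \<union> \<beta>)\<^sup>+"
  proof induction
    case (base y) then show ?case using a(3,6) b(3,6) z by blast
  next
    case (step y w)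
    then have "(y \<squnion> z, w \<squnion> z) \<in> \<alpha> \<union> \<beta>" using a(3,6) b(3,6) z by blast
    with step show ?case by (meson trancl.trancl_into_trancl)
  qed
  from \<open>(x, y) \<in> (\<alpha> \<union> \<beta>)\<^sup>+\<close> show "(x \<sqinter> z, y \<sqinter> z) \<in> (\<alpha> \<union> \<beta>)\<^sup>+"
  proof induction
    case (base y) then show ?case using a(3,7) b(3,7) z by blast
  next
    case (step y w)
    then have "(y \<sqinter> z, w \<sqinter> z) \<in> \<alpha> \<union> \<beta>" using a(3,7) b(3,7) z by blast
    with step show ?case by (meson trancl.trancl_into_trancl)
  qed
qed

text \<open>Each step of a chain of \<open>\<alpha>\<close>- and \<open>\<beta>\<close>-steps from \<open>u\<close> to \<open>v\<close> is retracted
  to \<open>[u, v] = {u, v}\<close> by \<open>w \<mapsto> (w \<squnion> u) \<sqinter> v\<close>.\<close>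
lemma Prime_trancl:
  assumes "lattice_congruence L \<alpha>" "lattice_congruence L \<beta>"
    and "(u, v) \<in> Prime L" "(u, v) \<in> (\<alpha> \<union> \<beta>)\<^sup>+"
  shows "(u, v) \<in> \<alpha> \<or> (u, v) \<in> \<beta>"
proof (rule ccontr)
  assume neg: "\<not> ?thesis"
  note a = lattice_congruenceD[OF assms(1)] and b = lattice_congruenceD[OF assms(2)]
  have uv: "u \<in> carrier L" "v \<in> carrier L" "u \<sqsubset> v"
    and cov: "\<And>z. z \<in> carrier L \<Longrightarrow> \<not> (u \<sqsubset> z \<and> z \<sqsubset> v)"
    using assms(3) by (auto simp: Prime_def)
  let ?r = "\<lambda>w. (w \<squnion> u) \<sqinter> v"
  have retract: "w \<in> carrier L \<and> ?r w = u" if yw: "(y, w) \<in> \<alpha> \<union> \<beta>" and y: "?r y = u" for y w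
  proof -
    have w: "w \<in> carrier L" using yw a(2) b(2) by auto
    have "(?r y, ?r w) \<in> \<alpha> \<union> \<beta>"
      using yw a(7)[OF a(6)[OF _ a(3)] a(3)] b(7)[OF b(6)[OF _ b(3)] b(3)] uv(1,2) by auto
    moreover have "u \<sqsubseteq> ?r w" "?r w \<sqsubseteq> v"
      using uv w by (auto intro!: meet_le join_right meet_right simp: lless_eq)
    then have "?r w = u \<or> ?r w = v"
      using cov[of "?r w"] uv w by (auto simp: lless_eq)
    ultimately show ?thesis using neg y w by auto
  qed
  have "?r u = u" using uv by (simp add: join_absorb meet_absorb lless_eq)
  have "w \<in> carrier L \<and> ?r w = u" if "(u, w) \<in> (\<alpha> \<union> \<beta>)\<^sup>+" for w
    using that
  proof induction
    case (base y) then show ?case using retract[OF _ \<open>?r u = u\<close>] by simp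
  next
    case (step y z) then show ?case using retract[of y z] by simp
  qed
  from this[OF assms(4)] uv show False
    by (simp add: join_absorb2 meet_absorb lless_eq)
qed

end

subsection \<open>Saturated chains\<close>

text \<open>A maximal chain of an interval is remembered only through the word of its colors, so
  that concatenating chains is appending lists, and the joins of interest depend on
  \<open>set l\<close> alone.\<close>

inductive saturated_chain ::
    "('a, 'c) gorder_scheme \<Rightarrow> ('a \<times> 'a \<Rightarrow> 'b) \<Rightarrow> 'a \<Rightarrow> 'a \<Rightarrow> 'b list \<Rightarrow> bool"
  for L col where
    refl: "x \<in> carrier L \<Longrightarrow> saturated_chain L col x x []"
  | step: "(x, y) \<in> Prime L \<Longrightarrow> saturated_chain L col y z l
      \<Longrightarrow> saturated_chain L col x z (col (x, y) # l)"

inductive_cases saturated_chain_NilE: "saturated_chain L col x y []"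
inductive_cases saturated_chain_ConsE: "saturated_chain L col x y (c # l)"

lemma saturated_chain_append:
  "saturated_chain L col x y (l @ m) \<longleftrightarrow>
    (\<exists>z. saturated_chain L col x z l \<and> saturated_chain L col z y m)"
proof (induction l arbitrary: x)
  case Nil
  have "x \<in> carrier L" if "saturated_chain L col x y m"
    using that by cases (auto simp: Prime_def)
  then show ?case
    by (auto elim: saturated_chain_NilE intro: saturated_chain.refl)
next
  case (Cons c l)
  show ?case
  proof
    assume "saturated_chain L col x y ((c # l) @ m)"
    then show "\<exists>z. saturated_chain L col x z (c # l) \<and> saturated_chain L col z y m"
      using Cons by (auto elim!: saturated_chain_ConsE intro: saturated_chain.step)
  next
    assume "\<exists>z. saturated_chain L col x z (c # l) \<and> saturated_chain L col z y m"
    then show "saturated_chain L col x y ((c # l) @ m)"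
      using Cons by (auto elim!: saturated_chain_ConsE intro!: saturated_chain.step)
  qed
qed

lemma saturated_chain_sublist:
  assumes "saturated_chain L col x y l" "sublist m l"
  shows "\<exists>u v. saturated_chain L col u v m"
proof -
  obtain ps ss where "l = ps @ m @ ss" using assms(2) by (auto simp: sublist_def)
  then show ?thesis using assms(1) saturated_chain_append by metis
qed

context partial_order
begin

lemma saturated_chain_le:
  assumes "saturated_chain L col x y l"
  shows "x \<in> carrier L \<and> y \<in> carrier L \<and> x \<sqsubseteq> y"
  using assms
proof induction
  case (step x y z l)
  then show ?case using le_trans[of x y z] by (auto simp: Prime_def lless_eq)
qed simp

lemma at_least_at_most_mono:
  assumes "x \<sqsubseteq> x'" "y' \<sqsubseteq> y" "x \<in> carrier L" "x' \<in> carrier L" "y \<in> carrier L" "y' \<in> carrier L"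
  shows "\<lbrace>x'..y'\<rbrace> \<subseteq> \<lbrace>x..y\<rbrace>"
  using assms le_trans[of x x'] le_trans[of _ y' y] by (auto simp: at_least_at_most_def)

text \<open>Induction on the size of the interval: an element strictly between the endpoints splits
  it into two smaller intervals, whose words are appended.\<close>

lemma saturated_chain_exists:
  assumes fin: "finite (carrier L)" and "x \<in> carrier L" "y \<in> carrier L" "x \<sqsubseteq> y"
  shows "\<exists>l. saturated_chain L col x y l"
  using assms(2-)
proof (induction "card \<lbrace>x..y\<rbrace>" arbitrary: x y rule: less_induct)
  case less
  have fin_int: "finite \<lbrace>x..y\<rbrace>"
    using fin by (rule finite_subset[rotated]) (auto simp: at_least_at_most_def)
  consider "x = y" | "(x, y) \<in> Prime L" | z where "z \<in> carrier L" "x \<sqsubset> z" "z \<sqsubset> y"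
    using less.prems by (auto simp: Prime_def lless_eq)
  then show ?case
  proof cases
    case 1
    then have "saturated_chain L col x y []" using less.prems by (simp add: saturated_chain.refl)
    then show ?thesis ..
  next
    case 2
    from saturated_chain.step[OF this saturated_chain.refl] show ?thesis
      using less.prems by blast
  next
    case (3 z)
    have "\<lbrace>x..z\<rbrace> \<subset> \<lbrace>x..y\<rbrace>"
    proof
      show "\<lbrace>x..z\<rbrace> \<subseteq> \<lbrace>x..y\<rbrace>"
        using 3 less.prems by (intro at_least_at_most_mono) (auto simp: lless_eq)
      have "y \<in> \<lbrace>x..y\<rbrace>" "y \<notin> \<lbrace>x..z\<rbrace>"
        using 3 less.prems by (auto simp: at_least_at_most_def lless_eq)
      then show "\<lbrace>x..z\<rbrace> \<noteq> \<lbrace>x..y\<rbrace>" by blast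
    qed
    then obtain l where l: "saturated_chain L col x z l"
      using less.hyps[of x z] 3 less.prems psubset_card_mono[OF fin_int] by (auto simp: lless_eq)
    have "\<lbrace>z..y\<rbrace> \<subset> \<lbrace>x..y\<rbrace>"
    proof
      show "\<lbrace>z..y\<rbrace> \<subseteq> \<lbrace>x..y\<rbrace>"
        using 3 less.prems by (intro at_least_at_most_mono) (auto simp: lless_eq)
      have "x \<in> \<lbrace>x..y\<rbrace>" "x \<notin> \<lbrace>z..y\<rbrace>"
        using 3 less.prems by (auto simp: at_least_at_most_def lless_eq)
      then show "\<lbrace>z..y\<rbrace> \<noteq> \<lbrace>x..y\<rbrace>" by blast
    qed
    then obtain m where m: "saturated_chain L col z y m"
      using less.hyps[of z y] 3 less.prems psubset_card_mono[OF fin_int] by (auto simp: lless_eq)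
    from l m have "saturated_chain L col x y (l @ m)" unfolding saturated_chain_append by blast
    then show ?thesis ..
  qed
qed

end

text \<open>Since the word has forgotten its prime intervals, the hypothesis speaks of all prime
  intervals of \<open>L\<close> whose color occurs in it. In the application the color decides
  whether a prime interval is collapsed.\<close>

lemma (in lattice) saturated_chain_congruence:
  assumes "lattice_congruence L \<theta>" "saturated_chain L col x y l"
    and "\<And>u v. (u, v) \<in> Prime L \<Longrightarrow> col (u, v) \<in> set l \<Longrightarrow> (u, v) \<in> \<theta>"
  shows "(x, y) \<in> \<theta>"
  using assms(2,3)
proof induction
  case (refl x) then show ?case using lattice_congruenceD(3)[OF assms(1)] by blast
next
  case (step x y z l)
  then show ?case using lattice_congruenceD(5)[OF assms(1)] by (metis list.set_intros(1,2))
qed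

text \<open>Convexity passes the collapse of the endpoints on to each prime interval of the
  chain.\<close>

lemma (in lattice) saturated_chain_collapsed:
  assumes "lattice_congruence L \<theta>" "saturated_chain L col x y l" "(x, y) \<in> \<theta>" "c \<in> set l"
  shows "\<exists>u v. (u, v) \<in> Prime L \<and> (u, v) \<in> \<theta> \<and> c = col (u, v)"
  using assms(2-)
proof induction
  case (refl x) then show ?case by simp
next
  case (step x y z l)
  have "x \<sqsubseteq> y" "y \<sqsubseteq> z" "y \<in> carrier L"
    using step.hyps(1) saturated_chain_le[OF step.hyps(2)] by (auto simp: Prime_def lless_eq)
  then have "(x, y) \<in> \<theta>" "(y, z) \<in> \<theta>" using congruence_convex[OF assms(1) step.prems(1)] by auto
  with step show ?case by auto
qed

subsection \<open>Words of colors\<close>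

context finite_chain
begin

text \<open>In a chain no prime interval straddles the cover of \<open>x\<close>. Hence the prime
  intervals above \<open>x\<close> are the first one and those above the cover, which matches the
  recursion of the word.\<close>

lemma saturated_chain_colSet:
  assumes "saturated_chain C col x y l"
  shows "colSet C col x y = set l"
proof -
  have "col ` {p \<in> Prime C. x \<sqsubseteq> fst p \<and> snd p \<sqsubseteq> y} = set l"
    using assms
  proof induction
    case (refl x)
    have "v = u" if "x \<sqsubseteq> u" "u \<sqsubseteq> v" "v \<sqsubseteq> x" "u \<in> carrier C" "v \<in> carrier C" for u v
      using that refl by (meson le_antisym le_trans)
    then show ?case by (auto simp: Prime_def lless_eq)
  next
    case (step x x' y l)
    have c: "x \<in> carrier C" "x' \<in> carrier C" "y \<in> carrier C" "x \<sqsubseteq> x'" "x' \<sqsubseteq> y"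
      using step.hyps(1) saturated_chain_le[OF step.hyps(2)] by (auto simp: Prime_def lless_eq)
    have "(u, v) = (x, x') \<or> x' \<sqsubseteq> u" if "(u, v) \<in> Prime C" "x \<sqsubseteq> u" for u v
      using that step.hyps(1) total_order_total[of u x'] total_order_total[of v x']
        by (auto simp: Prime_def lless_eq)
    then have "{p \<in> Prime C. x \<sqsubseteq> fst p \<and> snd p \<sqsubseteq> y}
      = insert (x, x') {p \<in> Prime C. x' \<sqsubseteq> fst p \<and> snd p \<sqsubseteq> y}"
      if "\<And>u v. (u, v) \<in> Prime C \<Longrightarrow> x' \<sqsubseteq> u \<Longrightarrow> x \<sqsubseteq> u"
      using step.hyps(1) c that by force
    moreover have "x \<sqsubseteq> u" if "(u, v) \<in> Prime C" "x' \<sqsubseteq> u" for u v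
      using that c le_trans[of x x' u] by (auto simp: Prime_def)
    ultimately have "{p \<in> Prime C. x \<sqsubseteq> fst p \<and> snd p \<sqsubseteq> y}
      = insert (x, x') {p \<in> Prime C. x' \<sqsubseteq> fst p \<and> snd p \<sqsubseteq> y}" by blast
    then show ?case using step.IH by simp
  qed
  moreover
  have "\<lbrace>u..v\<rbrace> \<subseteq> \<lbrace>x..y\<rbrace> \<longleftrightarrow> x \<sqsubseteq> u \<and> v \<sqsubseteq> y" if "(u, v) \<in> Prime C" for u v
  proof
    assume "\<lbrace>u..v\<rbrace> \<subseteq> \<lbrace>x..y\<rbrace>"
    moreover have "u \<in> \<lbrace>u..v\<rbrace>" "v \<in> \<lbrace>u..v\<rbrace>"
      using that by (auto simp: Prime_def lless_eq at_least_at_most_def)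
    ultimately show "x \<sqsubseteq> u \<and> v \<sqsubseteq> y" by (auto simp: at_least_at_most_def)
  next
    assume "x \<sqsubseteq> u \<and> v \<sqsubseteq> y"
    then show "\<lbrace>u..v\<rbrace> \<subseteq> \<lbrace>x..y\<rbrace>"
      using that saturated_chain_le[OF assms]
      by (intro at_least_at_most_mono) (auto simp: Prime_def)
  qed
  then have "colSet C col x y = col ` {p \<in> Prime C. x \<sqsubseteq> fst p \<and> snd p \<sqsubseteq> y}"
    unfolding colSet_def by force
  ultimately show ?thesis by simp
qed

lemma saturated_chain_unique:
  assumes "saturated_chain C col x y l" "saturated_chain C col x y m"
  shows "l = m"
  using assms
proof (induction arbitrary: m)
  case (refl x)
  show ?case using refl(2)
  proof cases
    case (step w l)
    then show ?thesis using saturated_chain_le[OF step(3)]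
      by (auto simp: Prime_def lless_eq)
  qed simp
next
  case (step x x' y l)
  show ?case using step.prems
  proof cases
    case refl
    then show ?thesis using step.hyps saturated_chain_le[OF step.hyps(2)]
      by (auto simp: Prime_def lless_eq)
  next
    case (step w l')
    have "w = x'"
      using step \<open>(x, x') \<in> Prime C\<close> total_order_total[of w x'] by (auto simp: Prime_def lless_eq)
    then show ?thesis using step \<open>\<And>m. saturated_chain C col x' y m \<Longrightarrow> l = m\<close> by simp
  qed
qed

text \<open>Intervals of the chain correspond to contiguous subwords: \<open>x\<close> and
  \<open>y\<close> cut the unique maximal chain into three pieces, of which the middle one spells
  the interval.\<close>

lemma colSet_saturated_chain:
  assumes cs: "saturated_chain C col b t cs"
    and b: "\<And>x. x \<in> carrier C \<Longrightarrow> b \<sqsubseteq> x" and t: "\<And>x. x \<in> carrier C \<Longrightarrow> x \<sqsubseteq> t"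
  shows "{colSet C col x y |x y. x \<in> carrier C \<and> y \<in> carrier C \<and> x \<sqsubseteq> y}
    = {set l |l. sublist l cs}"
proof (intro equalityI subsetI)
  fix S assume "S \<in> {colSet C col x y |x y. x \<in> carrier C \<and> y \<in> carrier C \<and> x \<sqsubseteq> y}"
  then obtain x y where xy: "S = colSet C col x y" "x \<in> carrier C" "y \<in> carrier C" "x \<sqsubseteq> y"
    by blast
  have "b \<in> carrier C" "t \<in> carrier C" using saturated_chain_le[OF cs] by auto
  then obtain l1 l2 l3 where l: "saturated_chain C col b x l1" "saturated_chain C col x y l2"
    "saturated_chain C col y t l3"
    using saturated_chain_exists[OF finite_carrier] xy b t by metis
  then have "saturated_chain C col b t (l1 @ l2 @ l3)"
    using saturated_chain_append by metis
  then have "sublist l2 cs" using saturated_chain_unique[OF cs] by auto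
  moreover have "S = set l2" using l xy saturated_chain_colSet by simp
  ultimately show "S \<in> {set l |l. sublist l cs}" by blast
next
  fix S assume "S \<in> {set l |l. sublist l cs}"
  then obtain l where l: "S = set l" "sublist l cs" by blast
  then obtain u v where "saturated_chain C col u v l"
    using saturated_chain_sublist[OF cs] by blast
  then show "S \<in> {colSet C col x y |x y. x \<in> carrier C \<and> y \<in> carrier C \<and> x \<sqsubseteq> y}"
    using saturated_chain_colSet saturated_chain_le l by blast
qed

lemma Rep_saturated_chain:
  assumes cs: "saturated_chain C col b t cs"
    and b: "\<And>x. x \<in> carrier C \<Longrightarrow> b \<sqsubseteq> x" and t: "\<And>x. x \<in> carrier C \<Longrightarrow> x \<sqsubseteq> t"
  shows "col ` Prime C = set cs" "Rep D C col = {\<Squnion>\<^bsub>D\<^esub> (set l) |l. sublist l cs}"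
proof -
  have "b \<in> carrier C" "t \<in> carrier C" using saturated_chain_le[OF cs] by auto
  then have "\<lbrace>u..v\<rbrace> \<subseteq> \<lbrace>b..t\<rbrace>" if "(u, v) \<in> Prime C" for u v
    using that b t by (intro at_least_at_most_mono) (auto simp: Prime_def)
  then have "colSet C col b t = col ` Prime C"
    unfolding colSet_def by force
  then show "col ` Prime C = set cs" using saturated_chain_colSet[OF cs] by simp
  have "Rep D C col = {\<Squnion>\<^bsub>D\<^esub> S |S.
      S \<in> {colSet C col x y |x y. x \<in> carrier C \<and> y \<in> carrier C \<and> x \<sqsubseteq> y}}"
    unfolding Rep_def Rep_interval_def by blast
  also have "\<dots> = {\<Squnion>\<^bsub>D\<^esub> S |S. S \<in> {set l |l. sublist l cs}}"
    by (simp only: colSet_saturated_chain[OF cs b t])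
  also have "\<dots> = {\<Squnion>\<^bsub>D\<^esub> (set l) |l. sublist l cs}" by blast
  finally show "Rep D C col = {\<Squnion>\<^bsub>D\<^esub> (set l) |l. sublist l cs}" .
qed

end

text \<open>Only the word of a colored chain matters, and every word occurs; from here on chains are
  replaced by lists of join-irreducible elements.\<close>

lemma chain_representable_iff:
  "chain_representable D Q \<longleftrightarrow>
    (\<exists>cs. set cs = join_irreducibles D \<and> Q = {\<Squnion>\<^bsub>D\<^esub> (set l) |l. sublist l cs})"
proof
  assume "chain_representable D Q"
  then obtain C :: "nat gorder" and col where C: "finite_chain C"
    and col: "coloring C (join_irreducibles D) col" and Q: "Q = Rep D C col"
    by (auto simp: chain_representable_def)
  interpret C: finite_chain C by (rule C)
  interpret C': finite_nonempty_lattice C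
    by (intro finite_nonempty_lattice.intro finite_nonempty_lattice_axioms.intro
        C.finite_carrier C.carrier_nonempty C.weak.lattice_axioms)
  obtain cs where cs: "saturated_chain C col \<bottom>\<^bsub>C\<^esub> \<top>\<^bsub>C\<^esub> cs"
    using C.saturated_chain_exists[OF C.finite_carrier] by (meson C'.bottom_closed C'.bottom_lower C'.top_closed)
  have "set cs = join_irreducibles D"
    using C.Rep_saturated_chain(1)[OF cs C'.bottom_lower C'.top_higher] col
    by (simp add: coloring_def)
  moreover have "Q = {\<Squnion>\<^bsub>D\<^esub> (set l) |l. sublist l cs}"
    using C.Rep_saturated_chain(2)[OF cs C'.bottom_lower C'.top_higher] Q by simp
  ultimately show "\<exists>cs. set cs = join_irreducibles D \<and> Q = {\<Squnion>\<^bsub>D\<^esub> (set l) |l. sublist l cs}"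
    by blast
next
  assume "\<exists>cs. set cs = join_irreducibles D \<and> Q = {\<Squnion>\<^bsub>D\<^esub> (set l) |l. sublist l cs}"
  then obtain cs where cs: "set cs = join_irreducibles D"
    and Q: "Q = {\<Squnion>\<^bsub>D\<^esub> (set l) |l. sublist l cs}" by blast
  \<comment> \<open>A word of length n needs n + 1 vertices; the prime interval from i to i + 1 gets
    the letter \<open>cs ! i\<close>.\<close>
  define C :: "nat gorder" where "C = \<lparr>carrier = {..length cs}, eq = (=), le = (\<le>)\<rparr>"
  define col where "col = (\<lambda>(i, j :: nat). cs ! i)"
  interpret C: finite_chain C
    by unfold_locales (auto simp: C_def)
  have "saturated_chain C col i (length cs) (drop i cs)" if "i \<le> length cs" for i
    using that
  proof (induction rule: inc_induct)
    case base then show ?case by (simp add: saturated_chain.refl C_def)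
  next
    case (step i)
    have "(i, Suc i) \<in> Prime C" using step by (auto simp: Prime_def C_def lless_def)
    from saturated_chain.step[OF this step.IH] show ?case
      using step by (simp add: col_def Cons_nth_drop_Suc)
  qed
  from this[of 0] have "saturated_chain C col 0 (length cs) cs" by simp
  note this [THEN C.Rep_saturated_chain(1)] this [THEN C.Rep_saturated_chain(2), where D = D]
  then have "col ` Prime C = set cs" "Rep D C col = Q"
    unfolding Q by (simp_all add: C_def)
  then show "chain_representable D Q"
    unfolding chain_representable_def coloring_def using C.finite_chain_axioms cs by metis
qed

subsection \<open>Join-irreducible elements\<close>

context finite_nonempty_lattice
begin

lemma sup_le_iff:
  assumes "S \<subseteq> carrier L" "y \<in> carrier L"
  shows "\<Squnion> S \<sqsubseteq> y \<longleftrightarrow> (\<forall>x\<in>S. x \<sqsubseteq> y)"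
proof
  assume le: "\<Squnion> S \<sqsubseteq> y"
  show "\<forall>x\<in>S. x \<sqsubseteq> y"
  proof
    fix x assume "x \<in> S"
    then show "x \<sqsubseteq> y"
      using le_trans[OF sup_upper le] assms sup_closed[OF assms(1)] by blast
  qed
next
  assume "\<forall>x\<in>S. x \<sqsubseteq> y"
  then show "\<Squnion> S \<sqsubseteq> y" using assms by (intro sup_least) auto
qed

lemma eq_iff_upper:
  assumes "x \<in> carrier L" "y \<in> carrier L"
    and "\<And>z. z \<in> carrier L \<Longrightarrow> x \<sqsubseteq> z \<longleftrightarrow> y \<sqsubseteq> z"
  shows "x = y"
  using assms le_antisym by (meson le_refl)

lemma join_le_iff:
  assumes "x \<in> carrier L" "y \<in> carrier L" "z \<in> carrier L"
  shows "x \<squnion> y \<sqsubseteq> z \<longleftrightarrow> x \<sqsubseteq> z \<and> y \<sqsubseteq> z"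
  using sup_le_iff[of "{x, y}" z] assms by (simp add: join_def)

lemma sup_insert:
  assumes "x \<in> carrier L" "S \<subseteq> carrier L"
  shows "\<Squnion> (insert x S) = x \<squnion> \<Squnion> S"
proof (rule eq_iff_upper)
  show "\<Squnion> (insert x S) \<sqsubseteq> z \<longleftrightarrow> x \<squnion> \<Squnion> S \<sqsubseteq> z" if "z \<in> carrier L" for z
    using assms that by (simp add: sup_le_iff join_le_iff)
qed (use assms in auto)

lemma sup_singleton: "x \<in> carrier L \<Longrightarrow> \<Squnion> {x} = x"
  by (rule eq_iff_upper) (simp_all add: sup_le_iff)

lemma join_irreducible_carrier: "join_irreducibles L \<subseteq> carrier L"
  by (auto simp: join_irreducibles_def)

end

context finite_distributive_lattice
begin

text \<open>Distributivity turns join-irreducible into join-prime. The empty join is excluded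
  because \<open>j\<close> is not the zero.\<close>

lemma join_irreducible_le_sup:
  assumes j: "j \<in> join_irreducibles D" and S: "S \<subseteq> carrier D" and le: "j \<sqsubseteq> \<Squnion> S"
  shows "\<exists>s\<in>S. j \<sqsubseteq> s"
proof -
  have jc: "j \<in> carrier D" and bot: "j \<noteq> \<bottom>"
    and irr: "\<And>x y. x \<in> carrier D \<Longrightarrow> y \<in> carrier D \<Longrightarrow> j = x \<squnion> y \<Longrightarrow> j = x \<or> j = y"
    using j by (auto simp: join_irreducibles_def)
  have "finite S" using S finite_carrier by (rule finite_subset)
  then show ?thesis using S le
  proof (induction S)
    case empty
    then have "j \<sqsubseteq> \<bottom>"
      using jc by (meson bottom_closed bottom_lower le_trans sup_closed sup_least empty_iff)
    then show ?case using bot jc le_antisym[of j \<bottom>] by simp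
  next
    case (insert x S)
    then have c: "x \<in> carrier D" "S \<subseteq> carrier D" "\<Squnion> S \<in> carrier D" by auto
    have "j \<sqsubseteq> x \<squnion> \<Squnion> S" using insert.prems c sup_insert[of x S] by simp
    then have "j = j \<sqinter> (x \<squnion> \<Squnion> S)" using jc c by (simp add: meet_absorb)
    also have "\<dots> = (j \<sqinter> x) \<squnion> (j \<sqinter> \<Squnion> S)" using jc c by (simp add: meet_join_distrib)
    finally have "j = j \<sqinter> x \<or> j = j \<sqinter> \<Squnion> S"
      by (rule irr[rotated 2]) (use jc c in auto)
    then have "j \<sqsubseteq> x \<or> j \<sqsubseteq> \<Squnion> S" using jc c le_iff_join by blast
    then show ?case using insert.IH c by auto
  qed
qed

end

subsection \<open>Words from principal congruences\<close>

lemma (in lattice) congruence_Id_on: "lattice_congruence L (Id_on (carrier L))"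
  by (rule congruence_of_translations)
    (auto intro!: equivI refl_onI symI transI simp: Id_on_def)

text \<open>A nonempty suffix of \<open>l @ [t]\<close> ends in \<open>t\<close>, so a subword that
  runs over the end of a piece contains the separator.\<close>

lemma sublist_concat_separated:
  assumes "sublist m (concat (map (\<lambda>l. l @ [t]) ls))"
  shows "m = [] \<or> t \<in> set m \<or> (\<exists>l\<in>set ls. sublist m l)"
  using assms
proof (induction ls arbitrary: m)
  case (Cons l ls)
  let ?w = "concat (map (\<lambda>l. l @ [t]) ls)"
  have suffix: "m1 = [] \<or> t \<in> set m1" if "suffix m1 (l @ [t])" for m1
    using that by (cases m1 rule: rev_cases) auto
  have "sublist m ((l @ [t]) @ ?w)" using Cons.prems by simp
  then consider "suffix m (l @ [t])" | "sublist m l" | "sublist m ?w"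
    | m1 m2 where "m = m1 @ m2" "suffix m1 (l @ [t])" "prefix m2 ?w"
    unfolding sublist_append[of m "l @ [t]"] sublist_snoc by blast
  then show ?case
  proof cases
    case (4 m1 m2)
    then have "sublist m2 ?w" by simp
    then show ?thesis using Cons.IH[of m2] suffix[OF 4(2)] 4(1) by auto
  qed (use suffix Cons.IH in auto)
qed simp

locale representation =
  D: finite_distributive_lattice D + L: finite_nonempty_lattice L for D and L +
  fixes \<phi>
  assumes iso: "lattice_isomorphism D (Con L) \<phi>"
begin

definition inv_iso where "inv_iso = inv_into (carrier D) \<phi>"

text \<open>Defined for all pairs, not only for prime intervals: in general it is the element of
  \<open>D\<close> belonging to the generated congruence, which turns out to be the join of the
  colors along a maximal chain.\<close>

definition col where "col p = inv_iso (con L (fst p) (snd p))"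

lemma \<phi>_congruence: "d \<in> carrier D \<Longrightarrow> lattice_congruence L (\<phi> d)"
  using iso by (auto simp: lattice_isomorphism_def bij_betw_def)

lemma inv_iso:
  assumes "lattice_congruence L \<theta>"
  shows "inv_iso \<theta> \<in> carrier D" "\<phi> (inv_iso \<theta>) = \<theta>"
proof -
  have "\<theta> \<in> \<phi> ` carrier D"
    using assms iso by (auto simp: lattice_isomorphism_def bij_betw_def)
  then show "inv_iso \<theta> \<in> carrier D" "\<phi> (inv_iso \<theta>) = \<theta>"
    unfolding inv_iso_def by (rule inv_into_into, rule f_inv_into_f)
qed

lemma inv_iso_\<phi>: "d \<in> carrier D \<Longrightarrow> inv_iso (\<phi> d) = d"
  using iso unfolding inv_iso_def by (simp add: lattice_isomorphism_def bij_betw_def)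

lemma \<phi>_subset_iff: "c \<in> carrier D \<Longrightarrow> d \<in> carrier D \<Longrightarrow> \<phi> c \<subseteq> \<phi> d \<longleftrightarrow> c \<sqsubseteq>\<^bsub>D\<^esub> d"
  using lattice_isomorphism_le_iff[OF iso] by simp

lemma col_closed: "u \<in> carrier L \<Longrightarrow> v \<in> carrier L \<Longrightarrow> col (u, v) \<in> carrier D"
  by (simp add: col_def inv_iso L.con_congruence)

text \<open>The universal property of the generated congruence, read in \<open>D\<close>. It turns
  inequalities between colors into the question whether a congruence identifies two
  elements.\<close>

lemma col_le_iff:
  assumes "u \<in> carrier L" "v \<in> carrier L" "d \<in> carrier D"
  shows "col (u, v) \<sqsubseteq>\<^bsub>D\<^esub> d \<longleftrightarrow> (u, v) \<in> \<phi> d"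
  using \<phi>_subset_iff[of "col (u, v)" d] assms col_closed[of u v]
    inv_iso(2)[OF L.con_congruence(1), of u v] L.con_subset_iff[OF _ _ \<phi>_congruence, of u v d]
  by (simp add: col_def)

lemma saturated_chain_col:
  assumes "saturated_chain L col x y l"
  shows "set l \<subseteq> carrier D"
  using assms
proof induction
  case (step x y z l)
  then show ?case using col_closed[of x y] by (auto simp: Prime_def)
qed simp

text \<open>Both sides have the same upper bounds: \<open>d\<close> is above all colors of the word
  iff \<open>\<phi> d\<close> collapses every prime interval of the chain, iff it identifies the
  endpoints.\<close>

lemma sup_saturated_chain:
  assumes "saturated_chain L col x y l"
  shows "\<Squnion>\<^bsub>D\<^esub> (set l) = col (x, y)"
proof (rule D.eq_iff_upper)
  note car = saturated_chain_col[OF assms]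
  note xy = L.saturated_chain_le[OF assms]
  fix d assume d: "d \<in> carrier D"
  have "(\<forall>c\<in>set l. c \<sqsubseteq>\<^bsub>D\<^esub> d) \<longleftrightarrow> (x, y) \<in> \<phi> d"
  proof
    assume le: "\<forall>c\<in>set l. c \<sqsubseteq>\<^bsub>D\<^esub> d"
    show "(x, y) \<in> \<phi> d"
    proof (rule L.saturated_chain_congruence[OF \<phi>_congruence[OF d] assms])
      fix u v assume "(u, v) \<in> Prime L" "col (u, v) \<in> set l"
      then show "(u, v) \<in> \<phi> d" using col_le_iff[of u v d] le d by (auto simp: Prime_def)
    qed
  next
    assume xyd: "(x, y) \<in> \<phi> d"
    show "\<forall>c\<in>set l. c \<sqsubseteq>\<^bsub>D\<^esub> d"
    proof
      fix c assume "c \<in> set l"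
      then obtain u v where "(u, v) \<in> Prime L" "(u, v) \<in> \<phi> d" "c = col (u, v)"
        using L.saturated_chain_collapsed[OF \<phi>_congruence[OF d] assms xyd] by blast
      then show "c \<sqsubseteq>\<^bsub>D\<^esub> d" using col_le_iff[of u v d] d by (auto simp: Prime_def)
    qed
  qed
  then show "\<Squnion>\<^bsub>D\<^esub> (set l) \<sqsubseteq>\<^bsub>D\<^esub> d \<longleftrightarrow> col (x, y) \<sqsubseteq>\<^bsub>D\<^esub> d"
    using car d xy by (simp add: D.sup_le_iff col_le_iff)
qed (use saturated_chain_col[OF assms] L.saturated_chain_le[OF assms] col_closed in auto)

text \<open>If the color is the join of \<open>a\<close> and \<open>b\<close>, then \<open>u\<close>
  and \<open>v\<close> are connected by steps of \<open>\<phi> a\<close> and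
  \<open>\<phi> b\<close>, so one of the two already collapses the prime interval, and the color
  lies below that summand.\<close>

lemma col_Prime:
  assumes "(u, v) \<in> Prime L"
  shows "col (u, v) \<in> join_irreducibles D"
proof -
  have uv: "u \<in> carrier L" "v \<in> carrier L" "u \<noteq> v"
    using assms by (auto simp: Prime_def L.lless_eq)
  note c = col_closed[OF uv(1,2)]
  have "col (u, v) \<noteq> \<bottom>\<^bsub>D\<^esub>"
  proof
    let ?i = "inv_iso (Id_on (carrier L))"
    note i = inv_iso[OF L.congruence_Id_on]
    assume "col (u, v) = \<bottom>\<^bsub>D\<^esub>"
    \<comment> \<open>The zero lies below the element that represents the identity relation, and
      this inequality already contradicts \<open>u \<noteq> v\<close>.\<close>
    then have "col (u, v) \<sqsubseteq>\<^bsub>D\<^esub> ?i" using i(1) by simp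
    then have "(u, v) \<in> Id_on (carrier L)" using col_le_iff[OF uv(1,2) i(1)] i(2) by simp
    then show False using uv by auto
  qed
  moreover have "col (u, v) = a \<or> col (u, v) = b"
    if ab: "a \<in> carrier D" "b \<in> carrier D" "col (u, v) = a \<squnion>\<^bsub>D\<^esub> b" for a b
  proof -
    let ?\<theta> = "(\<phi> a \<union> \<phi> b)\<^sup>+"
    note \<theta> = L.congruence_of_trancl[OF \<phi>_congruence[OF ab(1)] \<phi>_congruence[OF ab(2)]]
    note i = inv_iso[OF \<theta>]
    have "\<phi> a \<subseteq> ?\<theta>" "\<phi> b \<subseteq> ?\<theta>" by auto
    then have "a \<sqsubseteq>\<^bsub>D\<^esub> inv_iso ?\<theta>" "b \<sqsubseteq>\<^bsub>D\<^esub> inv_iso ?\<theta>"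
      using \<phi>_subset_iff[OF ab(1) i(1)] \<phi>_subset_iff[OF ab(2) i(1)] i(2) by simp_all
    then have "col (u, v) \<sqsubseteq>\<^bsub>D\<^esub> inv_iso ?\<theta>"
      using ab i(1) by (simp add: D.join_le_iff)
    then have "(u, v) \<in> ?\<theta>" using col_le_iff[OF uv(1,2) i(1)] i(2) by simp
    then have "(u, v) \<in> \<phi> a \<or> (u, v) \<in> \<phi> b"
      by (rule L.Prime_trancl[OF \<phi>_congruence[OF ab(1)] \<phi>_congruence[OF ab(2)] assms])
    then have "a \<squnion>\<^bsub>D\<^esub> b \<sqsubseteq>\<^bsub>D\<^esub> a \<or> a \<squnion>\<^bsub>D\<^esub> b \<sqsubseteq>\<^bsub>D\<^esub> b"
      using col_le_iff[OF uv(1,2)] ab by simp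
    then show ?thesis
      using ab D.le_antisym D.join_left D.join_right D.join_closed by metis
  qed
  ultimately show ?thesis using c by (simp add: join_irreducibles_def)
qed

text \<open>\<open>\<phi> j\<close> is generated by the prime intervals it collapses, so
  \<open>j\<close> is the join of the colors below it; join-primeness makes \<open>j\<close> one of
  them.\<close>

lemma join_irreducible_col:
  assumes j: "j \<in> join_irreducibles D"
  shows "j \<in> col ` Prime L"
proof -
  have jc: "j \<in> carrier D" using j by (simp add: join_irreducibles_def)
  define S where "S = {c \<in> col ` Prime L. c \<sqsubseteq>\<^bsub>D\<^esub> j}"
  have S: "S \<subseteq> carrier D"
    using col_closed by (auto simp: S_def Prime_def)
  have Sc: "\<Squnion>\<^bsub>D\<^esub> S \<in> carrier D" using S by simp
  have "\<phi> j \<subseteq> \<phi> (\<Squnion>\<^bsub>D\<^esub> S)"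
  proof
    fix p assume p: "p \<in> \<phi> j"
    obtain x y where xy: "p = (x, y)" "x \<in> carrier L" "y \<in> carrier L"
      using lattice_congruenceD(2)[OF \<phi>_congruence[OF jc]] p by auto
    have mj: "(x \<sqinter>\<^bsub>L\<^esub> y, x \<squnion>\<^bsub>L\<^esub> y) \<in> \<phi> j"
      using p xy L.congruence_meet_join_iff[OF \<phi>_congruence[OF jc]] by simp
    have "x \<sqinter>\<^bsub>L\<^esub> y \<sqsubseteq>\<^bsub>L\<^esub> x \<squnion>\<^bsub>L\<^esub> y"
      using xy L.le_trans[OF L.meet_left L.join_left, of x y y] by simp
    then obtain l where l: "saturated_chain L col (x \<sqinter>\<^bsub>L\<^esub> y) (x \<squnion>\<^bsub>L\<^esub> y) l"
      using L.saturated_chain_exists[OF L.finite_carrier, of "x \<sqinter>\<^bsub>L\<^esub> y" "x \<squnion>\<^bsub>L\<^esub> y" col] xy by auto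
    have "set l \<subseteq> S"
    proof
      fix c assume "c \<in> set l"
      then obtain u v where uv: "(u, v) \<in> Prime L" "(u, v) \<in> \<phi> j" "c = col (u, v)"
        using L.saturated_chain_collapsed[OF \<phi>_congruence[OF jc] l mj] by blast
      then have "c \<sqsubseteq>\<^bsub>D\<^esub> j" using col_le_iff[of u v j] jc by (auto simp: Prime_def)
      then show "c \<in> S" using uv by (auto simp: S_def)
    qed
    then have "\<forall>c\<in>set l. c \<sqsubseteq>\<^bsub>D\<^esub> \<Squnion>\<^bsub>D\<^esub> S" using D.sup_upper[OF S] by blast
    then have "\<Squnion>\<^bsub>D\<^esub> (set l) \<sqsubseteq>\<^bsub>D\<^esub> \<Squnion>\<^bsub>D\<^esub> S"
      using D.sup_le_iff[OF saturated_chain_col[OF l] Sc] by blast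
    then have "(x \<sqinter>\<^bsub>L\<^esub> y, x \<squnion>\<^bsub>L\<^esub> y) \<in> \<phi> (\<Squnion>\<^bsub>D\<^esub> S)"
      using sup_saturated_chain[OF l] col_le_iff[OF _ _ Sc] xy by simp
    then show "p \<in> \<phi> (\<Squnion>\<^bsub>D\<^esub> S)"
      using xy L.congruence_meet_join_iff[OF \<phi>_congruence[OF Sc]] by simp
  qed
  then have "j \<sqsubseteq>\<^bsub>D\<^esub> \<Squnion>\<^bsub>D\<^esub> S" using \<phi>_subset_iff[OF jc Sc] by simp
  then obtain s where "s \<in> S" "j \<sqsubseteq>\<^bsub>D\<^esub> s" using D.join_irreducible_le_sup[OF j S] by blast
  then have "j = s" using S jc D.le_antisym[of j s] by (auto simp: S_def)
  then show ?thesis using \<open>s \<in> S\<close> by (simp add: S_def)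
qed

lemma chain_representable:
  assumes top: "\<top>\<^bsub>D\<^esub> \<in> join_irreducibles D" and Q: "Q \<subseteq> carrier D" "\<phi> ` Q = Princ L"
  shows "chain_representable D Q"
proof -
  have Q_iff: "q \<in> Q \<longleftrightarrow> (\<exists>x y. x \<in> carrier L \<and> y \<in> carrier L \<and> x \<sqsubseteq>\<^bsub>L\<^esub> y \<and> q = col (x, y))" for q
  proof
    assume "q \<in> Q"
    then have "\<phi> q \<in> Princ L" "q \<in> carrier D" using Q by auto
    then obtain x y where xy: "x \<in> carrier L" "y \<in> carrier L" "x \<sqsubseteq>\<^bsub>L\<^esub> y" "\<phi> q = con L x y"
      unfolding L.Princ_eq by blast
    then have "q = col (x, y)" using inv_iso_\<phi>[OF \<open>q \<in> carrier D\<close>] by (simp add: col_def)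
    then show "\<exists>x y. x \<in> carrier L \<and> y \<in> carrier L \<and> x \<sqsubseteq>\<^bsub>L\<^esub> y \<and> q = col (x, y)"
      using xy by blast
  next
    assume "\<exists>x y. x \<in> carrier L \<and> y \<in> carrier L \<and> x \<sqsubseteq>\<^bsub>L\<^esub> y \<and> q = col (x, y)"
    then obtain x y where xy: "x \<in> carrier L" "y \<in> carrier L" "q = col (x, y)" by blast
    then have "con L x y \<in> \<phi> ` Q" unfolding Q(2) Princ_def by blast
    then obtain q' where "q' \<in> Q" "\<phi> q' = con L x y" by blast
    then have "q = q'" using inv_iso_\<phi>[of q'] Q(1) xy by (auto simp: col_def)
    then show "q \<in> Q" using \<open>q' \<in> Q\<close> by simp
  qed
  define W where "W = (\<lambda>p. SOME l. saturated_chain L col (fst p) (snd p) l)"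
  have W: "saturated_chain L col x y (W (x, y))"
    if "x \<in> carrier L" "y \<in> carrier L" "x \<sqsubseteq>\<^bsub>L\<^esub> y" for x y
    unfolding W_def fst_conv snd_conv
    by (rule someI_ex) (rule L.saturated_chain_exists[OF L.finite_carrier that])
  have "finite {(x, y). x \<in> carrier L \<and> y \<in> carrier L \<and> x \<sqsubseteq>\<^bsub>L\<^esub> y}"
    by (rule finite_subset[of _ "carrier L \<times> carrier L"]) (use L.finite_carrier in auto)
  from finite_list[OF this] obtain ps
    where ps: "set ps = {(x, y). x \<in> carrier L \<and> y \<in> carrier L \<and> x \<sqsubseteq>\<^bsub>L\<^esub> y}" ..
  \<comment> \<open>One word for every comparable pair makes each principal congruence a join over a
    subword. The unit after each word takes care of the subwords that leave it.\<close>
  define cs where "cs = concat (map (\<lambda>l. l @ [\<top>\<^bsub>D\<^esub>]) (map W ps))"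
  have set_W: "set (W (x, y)) \<subseteq> join_irreducibles D"
    if xy: "x \<in> carrier L" "y \<in> carrier L" "x \<sqsubseteq>\<^bsub>L\<^esub> y" for x y
  proof
    fix c assume "c \<in> set (W (x, y))"
    moreover have "(x, y) \<in> carrier L \<times> carrier L" using xy by simp
    ultimately obtain u v where "(u, v) \<in> Prime L" "c = col (u, v)"
      using L.saturated_chain_collapsed[OF L.lattice_congruence_Times W[OF xy]] by blast
    then show "c \<in> join_irreducibles D" using col_Prime by simp
  qed
  have W_sublist: "sublist (W p) cs" if "p \<in> set ps" for p
  proof -
    from split_list[OF that] obtain ps1 ps2 where "ps = ps1 @ p # ps2" by blast
    then have "cs = concat (map (\<lambda>l. l @ [\<top>\<^bsub>D\<^esub>]) (map W ps1)) @ W p @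
        (\<top>\<^bsub>D\<^esub> # concat (map (\<lambda>l. l @ [\<top>\<^bsub>D\<^esub>]) (map W ps2)))"
      by (simp add: cs_def)
    then show ?thesis by (simp only: sublist_appendI)
  qed
  have "set cs = join_irreducibles D"
  proof (intro equalityI subsetI)
    fix c assume "c \<in> set cs"
    then have "c = \<top>\<^bsub>D\<^esub> \<or> (\<exists>p\<in>set ps. c \<in> set (W p))" by (auto simp: cs_def split: if_splits)
    then show "c \<in> join_irreducibles D" using top set_W unfolding ps by blast
  next
    fix j assume "j \<in> join_irreducibles D"
    then obtain u v where uv: "(u, v) \<in> Prime L" "j = col (u, v)"
      using join_irreducible_col by fastforce
    then have c: "u \<in> carrier L" "v \<in> carrier L" "u \<sqsubseteq>\<^bsub>L\<^esub> v" "u \<noteq> v"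
      by (auto simp: Prime_def L.lless_eq)
    \<comment> \<open>The word of a prime interval consists of its own color.\<close>
    from W[OF c(1-3)] have "j \<in> set (W (u, v))"
    proof cases
      case refl then show ?thesis using c by simp
    next
      case (step w l)
      have "w \<sqsubseteq>\<^bsub>L\<^esub> v" using L.saturated_chain_le[OF step(3)] by simp
      then have "w = v" using step(2) uv(1) by (auto simp: Prime_def L.lless_eq)
      then show ?thesis using step uv by simp
    qed
    moreover have "(u, v) \<in> set ps" using c ps by simp
    ultimately show "j \<in> set cs" using set_mono_sublist[OF W_sublist] by blast
  qed
  moreover have "Q = {\<Squnion>\<^bsub>D\<^esub> (set l) |l. sublist l cs}"
  proof (intro equalityI subsetI)
    fix q assume "q \<in> Q"
    then obtain x y where xy: "x \<in> carrier L" "y \<in> carrier L" "x \<sqsubseteq>\<^bsub>L\<^esub> y" "q = col (x, y)"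
      using Q_iff by blast
    then have "q = \<Squnion>\<^bsub>D\<^esub> (set (W (x, y)))" using sup_saturated_chain[OF W] by simp
    moreover have "sublist (W (x, y)) cs" using W_sublist ps xy by simp
    ultimately show "q \<in> {\<Squnion>\<^bsub>D\<^esub> (set l) |l. sublist l cs}" by blast
  next
    fix q assume "q \<in> {\<Squnion>\<^bsub>D\<^esub> (set l) |l. sublist l cs}"
    then obtain l where l: "q = \<Squnion>\<^bsub>D\<^esub> (set l)" "sublist l cs" by blast
    have lc: "set l \<subseteq> carrier D"
      using set_mono_sublist[OF l(2)] \<open>set cs = join_irreducibles D\<close> D.join_irreducible_carrier by blast
    have "\<exists>u v. saturated_chain L col u v l" if "\<exists>m\<in>set (map W ps). sublist l m"
    proof -
      from that obtain x y where "(x, y) \<in> set ps" "sublist l (W (x, y))" by auto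
      then show ?thesis using saturated_chain_sublist[OF W] ps by auto
    qed
    \<comment> \<open>The empty subword stands for a trivial interval at any element of
      \<open>L\<close>.\<close>
    moreover have "\<exists>u v. saturated_chain L col u v l" if "l = []"
      using saturated_chain.refl[of _ L col] L.carrier_nonempty that by blast
    ultimately consider "\<top>\<^bsub>D\<^esub> \<in> set l" | u v where "saturated_chain L col u v l"
      using sublist_concat_separated[OF l(2)[unfolded cs_def]] by blast
    then show "q \<in> Q"
    proof cases
      \<comment> \<open>The join is the unit, which is join-irreducible and therefore the color of a
        prime interval, hence in \<open>Q\<close>.\<close>
      case 1
      then have "\<top>\<^bsub>D\<^esub> \<sqsubseteq>\<^bsub>D\<^esub> q" using D.sup_upper[OF lc 1] l by simp
      moreover have "q \<in> carrier D" using l lc by simp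
      ultimately have "q = \<top>\<^bsub>D\<^esub>" using D.le_antisym[of q "\<top>\<^bsub>D\<^esub>"] by simp
      then obtain u v where "(u, v) \<in> Prime L" "q = col (u, v)"
        using join_irreducible_col[OF top] by fastforce
      then show ?thesis unfolding Q_iff by (auto simp: Prime_def L.lless_eq)
    next
      case (2 u v)
      then show ?thesis
        unfolding Q_iff using L.saturated_chain_le[OF 2] sup_saturated_chain[OF 2] l by metis
    qed
  qed
  ultimately show ?thesis unfolding chain_representable_iff by blast
qed

end

subsection \<open>Transport of a representation\<close>

lemma lattice_isomorphism_inv:
  assumes "lattice_isomorphism A B f"
  shows "lattice_isomorphism B A (inv_into (carrier A) f)"
proof (rule order_isomorphism_imp_lattice_isomorphism)
  let ?g = "inv_into (carrier A) f"
  have bij: "bij_betw f (carrier A) (carrier B)" and lat: "lattice A" "lattice B"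
    using assms by (auto simp: lattice_isomorphism_def join_pres_def)
  show "lattice B" by (rule lat)
  interpret A: lattice A by (rule lat)
  show "partial_order A" by (rule A.partial_order_axioms)
  show "bij_betw ?g (carrier B) (carrier A)" by (rule bij_betw_inv_into[OF bij])
  fix x y assume "x \<in> carrier B" "y \<in> carrier B"
  then have "?g x \<in> carrier A" "?g y \<in> carrier A" "f (?g x) = x" "f (?g y) = y"
    using bij by (auto simp: bij_betw_def f_inv_into_f inv_into_into)
  then show "?g x \<sqsubseteq>\<^bsub>A\<^esub> ?g y \<longleftrightarrow> x \<sqsubseteq>\<^bsub>B\<^esub> y"
    using lattice_isomorphism_le_iff[OF assms, of "?g x" "?g y"] by simp
qed

lemma lattice_congruence_image:
  assumes iso: "lattice_isomorphism A B f" and \<theta>: "lattice_congruence A \<theta>"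
  shows "lattice_congruence B (map_prod f f ` \<theta>)"
proof -
  have bij: "bij_betw f (carrier A) (carrier B)" and lat: "lattice A" "lattice B"
    and join: "\<And>x y. x \<in> carrier A \<Longrightarrow> y \<in> carrier A \<Longrightarrow> f (x \<squnion>\<^bsub>A\<^esub> y) = f x \<squnion>\<^bsub>B\<^esub> f y"
    and meet: "\<And>x y. x \<in> carrier A \<Longrightarrow> y \<in> carrier A \<Longrightarrow> f (x \<sqinter>\<^bsub>A\<^esub> y) = f x \<sqinter>\<^bsub>B\<^esub> f y"
    using iso by (auto simp: lattice_isomorphism_def join_pres_def meet_pres_def)
  have inj: "x = y" if "x \<in> carrier A" "y \<in> carrier A" "f x = f y" for x y
    using bij that by (auto simp: bij_betw_def inj_on_def)
  have car: "carrier B = f ` carrier A" using bij by (simp add: bij_betw_def)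
  note t = lattice_congruenceD[OF \<theta>]
  have c: "x \<in> carrier A" "y \<in> carrier A" if "(x, y) \<in> \<theta>" for x y using that t(2) by auto
  let ?\<theta> = "map_prod f f ` \<theta>"
  have mem: "p \<in> ?\<theta> \<longleftrightarrow> (\<exists>x y. (x, y) \<in> \<theta> \<and> p = (f x, f y))" for p
    by force
  show ?thesis
    unfolding lattice_congruence_def
  proof (intro conjI allI impI)
    show "equiv (carrier B) ?\<theta>"
    proof (rule equivI)
      show "?\<theta> \<subseteq> carrier B \<times> carrier B" using c by (auto simp: car)
      show "refl_on (carrier B) ?\<theta>" unfolding refl_on_def mem car using t(3) by blast
      show "sym ?\<theta>" unfolding sym_def mem using t(4) by blast
      show "trans ?\<theta>"
      proof (rule transI)
        fix u v w assume "(u, v) \<in> ?\<theta>" "(v, w) \<in> ?\<theta>"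
        then obtain x y y' z where *: "(x, y) \<in> \<theta>" "(y', z) \<in> \<theta>" "u = f x" "v = f y" "v = f y'" "w = f z"
          unfolding mem by blast
        then have "y = y'" using inj c by blast
        then show "(u, w) \<in> ?\<theta>" unfolding mem using * t(5) by blast
      qed
    qed
    fix a b c' d assume "(a, b) \<in> ?\<theta> \<and> (c', d) \<in> ?\<theta>"
    then obtain x y z w where *: "(x, y) \<in> \<theta>" "(z, w) \<in> \<theta>" "a = f x" "b = f y" "c' = f z" "d = f w"
      unfolding mem by blast
    show "(a \<squnion>\<^bsub>B\<^esub> c', b \<squnion>\<^bsub>B\<^esub> d) \<in> ?\<theta>"
      using t(6)[OF *(1,2)] join[OF c(1)[OF *(1)] c(1)[OF *(2)]] join[OF c(2)[OF *(1)] c(2)[OF *(2)]]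
      unfolding mem *(3-6) by metis
    show "(a \<sqinter>\<^bsub>B\<^esub> c', b \<sqinter>\<^bsub>B\<^esub> d) \<in> ?\<theta>"
      using t(7)[OF *(1,2)] meet[OF c(1)[OF *(1)] c(1)[OF *(2)]] meet[OF c(2)[OF *(1)] c(2)[OF *(2)]]
      unfolding mem *(3-6) by metis
  qed
qed

text \<open>Representability asks for a lattice on natural numbers, whereas the construction below
  lives on another type. A finite carrier embeds into the numbers, and congruences together with
  their generators are carried along.\<close>

lemma principal_congruence_representableI:
  fixes L :: "'b gorder"
  assumes "finite_nonempty_lattice L" and iso: "lattice_isomorphism D (Con L) \<phi>"
    and Q: "\<phi> ` Q = Princ L"
  shows "principal_congruence_representable D Q"
proof -
  interpret L: finite_nonempty_lattice L by fact
  obtain f :: "'b \<Rightarrow> nat" where inj: "inj_on f (carrier L)"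
    using finite_imp_inj_to_nat_seg[OF L.finite_carrier] by blast
  let ?h = "inv_into (carrier L) f"
  define L' :: "nat gorder"
    where "L' = \<lparr>carrier = f ` carrier L, eq = (=), le = \<lambda>m n. ?h m \<sqsubseteq>\<^bsub>L\<^esub> ?h n\<rparr>"
  have car: "carrier L' = f ` carrier L" by (simp add: L'_def)
  have h: "?h m \<in> carrier L" "f (?h m) = m" if "m \<in> carrier L'" for m
    using that by (auto simp: car inv_into_into f_inv_into_f)
  have po: "partial_order L'"
  proof
    fix x y z
    show "x \<sqsubseteq>\<^bsub>L'\<^esub> x" if "x \<in> carrier L'" using h[OF that] by (simp add: L'_def)
    show "x .=\<^bsub>L'\<^esub> y" if "x \<sqsubseteq>\<^bsub>L'\<^esub> y" "y \<sqsubseteq>\<^bsub>L'\<^esub> x" "x \<in> carrier L'" "y \<in> carrier L'"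
    proof -
      have "?h x = ?h y" using L.le_antisym that h[OF that(3)] h[OF that(4)] by (simp add: L'_def)
      then have "x = y" using h(2)[OF that(3)] h(2)[OF that(4)] by metis
      then show ?thesis by (simp add: L'_def)
    qed
    show "x \<sqsubseteq>\<^bsub>L'\<^esub> z" if "x \<sqsubseteq>\<^bsub>L'\<^esub> y" "y \<sqsubseteq>\<^bsub>L'\<^esub> z" "x \<in> carrier L'" "y \<in> carrier L'" "z \<in> carrier L'"
    proof -
      have "?h x \<sqsubseteq>\<^bsub>L\<^esub> ?h y" "?h y \<sqsubseteq>\<^bsub>L\<^esub> ?h z" using that(1,2) by (simp_all add: L'_def)
      then have "?h x \<sqsubseteq>\<^bsub>L\<^esub> ?h z" by (rule L.le_trans) (use that h in blast)+
      then show ?thesis by (simp add: L'_def)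
    qed
  qed (simp_all add: L'_def)
  have f: "lattice_isomorphism L L' f"
    by (rule order_isomorphism_imp_lattice_isomorphism[OF L.lattice_axioms po])
      (use inj in \<open>auto simp: L'_def bij_betw_def inv_into_f_f\<close>)
  then have "lattice L'" by (simp add: lattice_isomorphism_def join_pres_def)
  then interpret L': finite_nonempty_lattice L'
    by (intro finite_nonempty_lattice.intro finite_nonempty_lattice_axioms.intro)
      (simp_all add: car L.finite_carrier L.carrier_nonempty)
  note g = lattice_isomorphism_inv[OF f]
  let ?F = "\<lambda>\<theta>. map_prod f f ` \<theta>" and ?G = "\<lambda>\<theta>. map_prod ?h ?h ` \<theta>"
  have GF: "?G (?F \<theta>) = \<theta>" if "\<theta> \<subseteq> carrier L \<times> carrier L" for \<theta>
  proof -
    have "?G (?F \<theta>) = (\<lambda>p. p) ` \<theta>"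
      unfolding image_image by (rule image_cong) (use that inj in \<open>auto simp: inv_into_f_f\<close>)
    then show ?thesis by simp
  qed
  have FG: "?F (?G \<theta>) = \<theta>" if "\<theta> \<subseteq> carrier L' \<times> carrier L'" for \<theta>
  proof -
    have "?F (?G \<theta>) = (\<lambda>p. p) ` \<theta>"
      unfolding image_image by (rule image_cong) (use that h(2) in auto)
    then show ?thesis by simp
  qed
  have FC: "lattice_congruence L' (?F \<theta>)" if "lattice_congruence L \<theta>" for \<theta>
    by (rule lattice_congruence_image[OF f that])
  have GC: "lattice_congruence L (?G \<theta>)" if "lattice_congruence L' \<theta>" for \<theta>
    by (rule lattice_congruence_image[OF g that])
  have GF': "?G (?F \<theta>) = \<theta>" if "lattice_congruence L \<theta>" for \<theta>
    by (rule GF) (rule lattice_congruenceD(2)[OF that])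
  have FG': "?F (?G \<theta>) = \<theta>" if "lattice_congruence L' \<theta>" for \<theta>
    by (rule FG) (rule lattice_congruenceD(2)[OF that])
  have bij: "bij_betw ?F (carrier (Con L)) (carrier (Con L'))"
  proof (rule bij_betw_byWitness[where f' = ?G])
    show "\<forall>\<theta>\<in>carrier (Con L). ?G (?F \<theta>) = \<theta>" by (rule ballI, rule GF') simp
    show "\<forall>\<theta>\<in>carrier (Con L'). ?F (?G \<theta>) = \<theta>" by (rule ballI, rule FG') simp
    show "?F ` carrier (Con L) \<subseteq> carrier (Con L')" by (rule image_subsetI) (simp add: FC)
    show "?G ` carrier (Con L') \<subseteq> carrier (Con L)" by (rule image_subsetI) (simp add: GC)
  qed
  have bij': "bij_betw \<phi> (carrier D) (carrier (Con L))" and D: "lattice D"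
    using iso by (auto simp: lattice_isomorphism_def join_pres_def)
  have iso': "lattice_isomorphism D (Con L') (?F \<circ> \<phi>)"
  proof (rule order_isomorphism_imp_lattice_isomorphism[OF D partial_order_Con])
    show "bij_betw (?F \<circ> \<phi>) (carrier D) (carrier (Con L'))"
      by (rule bij_betw_trans[OF bij' bij])
    fix x y assume xy: "x \<in> carrier D" "y \<in> carrier D"
    then have "lattice_congruence L (\<phi> x)" "lattice_congruence L (\<phi> y)"
      using bij' by (auto simp: bij_betw_def)
    then have "?F (\<phi> x) \<subseteq> ?F (\<phi> y) \<longleftrightarrow> \<phi> x \<subseteq> \<phi> y"
      using GF' by (metis image_mono)
    then show "(?F \<circ> \<phi>) x \<sqsubseteq>\<^bsub>Con L'\<^esub> (?F \<circ> \<phi>) y \<longleftrightarrow> x \<sqsubseteq>\<^bsub>D\<^esub> y"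
      using lattice_isomorphism_le_iff[OF iso xy] by simp
  qed
  have con: "con L' (f x) (f y) = ?F (con L x y)"
    if "x \<in> carrier L" "y \<in> carrier L" for x y
  proof
    have fc: "f x \<in> carrier L'" "f y \<in> carrier L'" using that by (auto simp: car)
    note c = L.con_congruence[OF that] and c' = L'.con_congruence[OF fc]
    show "con L' (f x) (f y) \<subseteq> ?F (con L x y)"
      unfolding L'.con_subset_iff[OF fc FC[OF c(1)]] using c(2) by force
    \<comment> \<open>For this inclusion the minimality of the generated congruence is used in
      \<open>L\<close>: pull back, compare there, push forward.\<close>
    have "(?h (f x), ?h (f y)) \<in> ?G (con L' (f x) (f y))" using c'(2) by force
    then have "(x, y) \<in> ?G (con L' (f x) (f y))" using inj that by (simp add: inv_into_f_f)
    then have "con L x y \<subseteq> ?G (con L' (f x) (f y))"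
      using L.con_subset_iff[OF that GC[OF c'(1)]] by simp
    then have "?F (con L x y) \<subseteq> ?F (?G (con L' (f x) (f y)))" by (rule image_mono)
    then show "?F (con L x y) \<subseteq> con L' (f x) (f y)" using FG'[OF c'(1)] by simp
  qed
  have "(?F \<circ> \<phi>) ` Q = ?F ` Princ L" unfolding Q[symmetric] by (simp add: image_comp)
  also have "\<dots> = Princ L'"
  proof (intro equalityI subsetI)
    fix \<theta> assume "\<theta> \<in> ?F ` Princ L"
    then obtain x y where xy: "x \<in> carrier L" "y \<in> carrier L" "\<theta> = ?F (con L x y)"
      unfolding Princ_def by blast
    then have "\<theta> = con L' (f x) (f y)" using con by simp
    moreover have "f x \<in> carrier L'" "f y \<in> carrier L'" using xy car by auto
    ultimately show "\<theta> \<in> Princ L'" unfolding Princ_def by blast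
  next
    fix \<theta> assume "\<theta> \<in> Princ L'"
    then obtain u v where uv: "u \<in> carrier L'" "v \<in> carrier L'" "\<theta> = con L' u v"
      unfolding Princ_def by blast
    then obtain x y where "x \<in> carrier L" "y \<in> carrier L" "u = f x" "v = f y"
      unfolding car by blast
    then show "\<theta> \<in> ?F ` Princ L" unfolding Princ_def using con uv by blast
  qed
  finally show ?thesis
    unfolding principal_congruence_representable_def
    using L'.finite_nonempty_lattice_axioms iso' by blast
qed

subsection \<open>Finite lattices and their congruences\<close>

text \<open>If x \<le> x' are congruent, \<open>up\<close> moves x \<squnion> z to some y above x'.
  Classes being chains, y is comparable with x \<squnion> z. If it is above, it is also above x'
  \<squnion> z, which convexity then catches; if it is below, then x' \<le> x \<squnion> z and the
  two joins agree. \<open>down\<close> is dual. The point of the criterion is that joins and meets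
  need not be computed in the concrete lattice.\<close>

lemma (in lattice) congruence_of_chain_classes:
  assumes equiv: "equiv (carrier L) \<theta>"
    and chain: "\<And>x y. (x, y) \<in> \<theta> \<Longrightarrow> x \<sqsubseteq> y \<or> y \<sqsubseteq> x"
    and convex: "\<And>x y z. (x, z) \<in> \<theta> \<Longrightarrow> x \<sqsubseteq> y \<Longrightarrow> y \<sqsubseteq> z \<Longrightarrow> y \<in> carrier L \<Longrightarrow> (x, y) \<in> \<theta>"
    and up: "\<And>x x' y. (x, x') \<in> \<theta> \<Longrightarrow> x \<sqsubseteq> x' \<Longrightarrow> x \<sqsubseteq> y \<Longrightarrow> y \<in> carrier L
      \<Longrightarrow> \<exists>y'. (y, y') \<in> \<theta> \<and> x' \<sqsubseteq> y'"
    and down: "\<And>x y y'. (y, y') \<in> \<theta> \<Longrightarrow> y' \<sqsubseteq> y \<Longrightarrow> x \<sqsubseteq> y \<Longrightarrow> x \<in> carrier L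
      \<Longrightarrow> \<exists>x'. (x, x') \<in> \<theta> \<and> x' \<sqsubseteq> y'"
  shows "lattice_congruence L \<theta>"
proof (rule congruence_of_translations[OF equiv])
  have sym: "(y, x) \<in> \<theta>" if "(x, y) \<in> \<theta>" for x y using that equiv by (meson equivE symD)
  have trans: "(x, z) \<in> \<theta>" if "(x, y) \<in> \<theta>" "(y, z) \<in> \<theta>" for x y z
    using that equiv by (meson equivE transD)
  have car: "x \<in> carrier L \<and> y \<in> carrier L" if "(x, y) \<in> \<theta>" for x y
    using that equiv_type[OF equiv] by auto
  have refl: "(x, x) \<in> \<theta>" if "x \<in> carrier L" for x using that equiv by (meson equivE refl_onD)
  have join: "(x \<squnion> z, x' \<squnion> z) \<in> \<theta>" if *: "(x, x') \<in> \<theta>" "x \<sqsubseteq> x'" "z \<in> carrier L" for x x' z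
  proof -
    have c: "x \<in> carrier L" "x' \<in> carrier L" using car *(1) by auto
    obtain y where y: "(x \<squnion> z, y) \<in> \<theta>" "x' \<sqsubseteq> y"
      using up[OF *(1,2) join_left[of x z]] c * by auto
    have yc: "y \<in> carrier L" using car y by auto
    have mono: "x \<squnion> z \<sqsubseteq> x' \<squnion> z"
      using c * by (intro join_le) (auto intro: le_trans[OF *(2) join_left] join_right)
    from chain[OF y(1)] show ?thesis
    proof
      assume le: "x \<squnion> z \<sqsubseteq> y"
      have "z \<sqsubseteq> y" using le_trans[OF join_right le] c * yc by simp
      then have "x' \<squnion> z \<sqsubseteq> y" using y c * yc by (intro join_le) auto
      then show ?thesis using convex[OF y(1) mono] c * by simp
    next
      assume "y \<sqsubseteq> x \<squnion> z"
      then have "x' \<sqsubseteq> x \<squnion> z" using le_trans[OF y(2)] c * yc by simp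
      then have "x' \<squnion> z \<sqsubseteq> x \<squnion> z" using c * by (intro join_le) (auto intro: join_right)
      then have "x \<squnion> z = x' \<squnion> z" using mono c * by (intro le_antisym) auto
      then show ?thesis using refl[of "x \<squnion> z"] c * by simp
    qed
  qed
  have meet: "(x \<sqinter> z, x' \<sqinter> z) \<in> \<theta>" if *: "(x, x') \<in> \<theta>" "x' \<sqsubseteq> x" "z \<in> carrier L" for x x' z
  proof -
    have c: "x \<in> carrier L" "x' \<in> carrier L" using car *(1) by auto
    obtain y where y: "(x \<sqinter> z, y) \<in> \<theta>" "y \<sqsubseteq> x'"
      using down[OF *(1,2) meet_left[of x z]] c * by auto
    have yc: "y \<in> carrier L" using car y by auto
    have mono: "x' \<sqinter> z \<sqsubseteq> x \<sqinter> z"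
      using c * by (intro meet_le) (auto intro: le_trans[OF meet_left *(2)] meet_right)
    from chain[OF y(1)] show ?thesis
    proof
      assume "x \<sqinter> z \<sqsubseteq> y"
      then have "x \<sqinter> z \<sqsubseteq> x'" using le_trans[OF _ y(2)] c * yc by simp
      then have "x \<sqinter> z \<sqsubseteq> x' \<sqinter> z" using c * by (intro meet_le) (auto intro: meet_right)
      then have "x \<sqinter> z = x' \<sqinter> z" using mono c * by (intro le_antisym) auto
      then show ?thesis using refl[of "x \<sqinter> z"] c * by simp
    next
      assume le: "y \<sqsubseteq> x \<sqinter> z"
      have "y \<sqsubseteq> z" using le_trans[OF le meet_right] c * yc by simp
      then have "y \<sqsubseteq> x' \<sqinter> z" using y c * yc by (intro meet_le) auto
      then have "(y, x' \<sqinter> z) \<in> \<theta>" using convex[OF sym[OF y(1)] _ mono] c * by simp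
      then show ?thesis using trans[OF y(1)] by simp
    qed
  qed
  fix x y z assume xy: "(x, y) \<in> \<theta>" and z: "z \<in> carrier L"
  show "(x \<squnion> z, y \<squnion> z) \<in> \<theta>"
    using chain[OF xy] join[OF xy _ z] sym[OF join[OF sym[OF xy] _ z]] by blast
  show "(x \<sqinter> z, y \<sqinter> z) \<in> \<theta>"
    using chain[OF xy] meet[OF xy _ z] sym[OF meet[OF sym[OF xy] _ z]] by blast
qed

text \<open>Interpolation makes the common lower bounds of \<open>u\<close> and \<open>v\<close>
  directed, and a finite directed set has a greatest element; dually for upper bounds.\<close>

lemma (in partial_order) finite_lattice_of_interpolation:
  assumes fin: "finite (carrier L)"
    and bot: "b \<in> carrier L" "\<And>x. x \<in> carrier L \<Longrightarrow> b \<sqsubseteq> x"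
    and top: "t \<in> carrier L" "\<And>x. x \<in> carrier L \<Longrightarrow> x \<sqsubseteq> t"
    and interpolation: "\<And>x y u v. \<lbrakk>x \<in> carrier L; y \<in> carrier L; u \<in> carrier L; v \<in> carrier L;
      x \<sqsubseteq> u; x \<sqsubseteq> v; y \<sqsubseteq> u; y \<sqsubseteq> v\<rbrakk>
      \<Longrightarrow> \<exists>z\<in>carrier L. x \<sqsubseteq> z \<and> y \<sqsubseteq> z \<and> z \<sqsubseteq> u \<and> z \<sqsubseteq> v"
  shows "finite_nonempty_lattice L"
proof
  show "finite (carrier L)" "carrier L \<noteq> {}" using fin bot by auto
  fix u v assume uv: "u \<in> carrier L" "v \<in> carrier L"
  have "\<exists>z\<in>Lower L {u, v}. \<forall>x\<in>T. x \<sqsubseteq> z" if "finite T" "T \<subseteq> Lower L {u, v}" for T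
    using that
  proof induction
    case empty
    have "b \<in> Lower L {u, v}" using bot uv by (auto simp: Lower_def)
    then show ?case by blast
  next
    case (insert x T)
    then obtain z where z: "z \<in> Lower L {u, v}" "\<forall>x\<in>T. x \<sqsubseteq> z" by auto
    have "x \<in> Lower L {u, v}" using insert.prems by simp
    with z(1) obtain w where w: "w \<in> carrier L" "x \<sqsubseteq> w" "z \<sqsubseteq> w" "w \<sqsubseteq> u" "w \<sqsubseteq> v"
      using interpolation[of x z u v] uv by (auto simp: Lower_def)
    have "y \<sqsubseteq> w" if "y \<in> T" for y
      using that z w insert.prems le_trans[of y z w] by (auto simp: Lower_def)
    moreover have "w \<in> Lower L {u, v}" using w uv by (auto simp: Lower_def)
    ultimately show ?case using w by blast
  qed
  from this[of "Lower L {u, v}"] fin obtain z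
    where "z \<in> Lower L {u, v}" "\<forall>x\<in>Lower L {u, v}. x \<sqsubseteq> z"
    using finite_subset[OF Lower_closed fin] by blast
  then show "\<exists>s. is_glb L s {u, v}" by (auto simp: greatest_def)
  have "\<exists>z\<in>Upper L {u, v}. \<forall>x\<in>T. z \<sqsubseteq> x" if "finite T" "T \<subseteq> Upper L {u, v}" for T
    using that
  proof induction
    case empty
    have "t \<in> Upper L {u, v}" using top uv by (auto simp: Upper_def)
    then show ?case by blast
  next
    case (insert x T)
    then obtain z where z: "z \<in> Upper L {u, v}" "\<forall>x\<in>T. z \<sqsubseteq> x" by auto
    have "x \<in> Upper L {u, v}" using insert.prems by simp
    with z(1) obtain w where w: "w \<in> carrier L" "w \<sqsubseteq> x" "w \<sqsubseteq> z" "u \<sqsubseteq> w" "v \<sqsubseteq> w"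
      using interpolation[of u v x z] uv by (auto simp: Upper_def)
    have "w \<sqsubseteq> y" if "y \<in> T" for y
      using that z w insert.prems le_trans[of w z y] by (auto simp: Upper_def)
    moreover have "w \<in> Upper L {u, v}" using w uv by (auto simp: Upper_def)
    ultimately show ?case using w by blast
  qed
  from this[of "Upper L {u, v}"] fin obtain z
    where "z \<in> Upper L {u, v}" "\<forall>x\<in>Upper L {u, v}. z \<sqsubseteq> x"
    using finite_subset[OF Upper_closed fin] by blast
  then show "\<exists>s. is_lub L s {u, v}" by (auto simp: least_def)
qed

lemma (in lattice) join_eqI:
  assumes "x \<in> carrier L" "y \<in> carrier L" "z \<in> carrier L" "x \<sqsubseteq> z" "y \<sqsubseteq> z"
    and "\<And>w. w \<in> carrier L \<Longrightarrow> x \<sqsubseteq> w \<Longrightarrow> y \<sqsubseteq> w \<Longrightarrow> z \<sqsubseteq> w"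
  shows "x \<squnion> y = z"
  using assms by (intro le_antisym join_le assms(6)) (auto intro: join_left join_right)

lemma (in lattice) meet_eqI:
  assumes "x \<in> carrier L" "y \<in> carrier L" "z \<in> carrier L" "z \<sqsubseteq> x" "z \<sqsubseteq> y"
    and "\<And>w. w \<in> carrier L \<Longrightarrow> w \<sqsubseteq> x \<Longrightarrow> w \<sqsubseteq> y \<Longrightarrow> w \<sqsubseteq> z"
  shows "x \<sqinter> y = z"
  using assms by (intro le_antisym meet_le assms(6)) (auto intro: meet_left meet_right)

text \<open>Descent from \<open>a\<close>: if it is a join of two other elements, one of them is
  still not below \<open>b\<close>, and fewer elements lie below it.\<close>

lemma (in finite_nonempty_lattice) join_irreducible_separates:
  assumes "a \<in> carrier L" "b \<in> carrier L" "\<not> a \<sqsubseteq> b"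
  shows "\<exists>j\<in>join_irreducibles L. j \<sqsubseteq> a \<and> \<not> j \<sqsubseteq> b"
  using assms(1,3)
proof (induction "card {x \<in> carrier L. x \<sqsubseteq> a}" arbitrary: a rule: less_induct)
  case less
  show ?case
  proof (cases "a \<in> join_irreducibles L")
    case True then show ?thesis using less.prems by auto
  next
    case False
    have "a \<noteq> \<bottom>" using less.prems assms(2) by auto
    then obtain x y where xy: "x \<in> carrier L" "y \<in> carrier L" "a = x \<squnion> y" "a \<noteq> x" "a \<noteq> y"
      using False less.prems by (auto simp: join_irreducibles_def)
    then have "\<not> x \<sqsubseteq> b \<or> \<not> y \<sqsubseteq> b" using less.prems assms(2) by (auto simp: join_le_iff)
    then obtain z where z: "z \<in> carrier L" "z \<sqsubseteq> a" "z \<noteq> a" "\<not> z \<sqsubseteq> b"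
      using xy join_left[of x y] join_right[of x y] by metis
    have "{x \<in> carrier L. x \<sqsubseteq> z} \<subseteq> {x \<in> carrier L. x \<sqsubseteq> a}"
      using z less.prems le_trans[of _ z a] by auto
    moreover have "a \<in> {x \<in> carrier L. x \<sqsubseteq> a}" "a \<notin> {x \<in> carrier L. x \<sqsubseteq> z}"
      using z less.prems le_antisym[of z a] by auto
    ultimately have "{x \<in> carrier L. x \<sqsubseteq> z} \<subset> {x \<in> carrier L. x \<sqsubseteq> a}" by blast
    then have "card {x \<in> carrier L. x \<sqsubseteq> z} < card {x \<in> carrier L. x \<sqsubseteq> a}"
      using finite_carrier by (intro psubset_card_mono) auto
    from less.hyps[OF this z(1) z(4)] obtain j
      where j: "j \<in> join_irreducibles L" "j \<sqsubseteq> z" "\<not> j \<sqsubseteq> b" by blast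
    then have "j \<sqsubseteq> a"
      using le_trans[of j z a] z less.prems join_irreducible_carrier by auto
    then show ?thesis using j by blast
  qed
qed

subsection \<open>Block lattices\<close>

datatype 'b block_elem = Bot | Top | In 'b nat

text \<open>No transitive closure is taken: the graph will be bipartite, so a path upward changes
  its block at most once.\<close>

fun block_le :: "('b \<Rightarrow> 'b \<Rightarrow> bool) \<Rightarrow> ('b \<Rightarrow> 'b \<Rightarrow> nat \<Rightarrow> nat)
    \<Rightarrow> 'b block_elem \<Rightarrow> 'b block_elem \<Rightarrow> bool" where
  "block_le adj phi Bot y = True"
| "block_le adj phi Top y = (y = Top)"
| "block_le adj phi (In b k) Bot = False"
| "block_le adj phi (In b k) Top = True"
| "block_le adj phi (In b k) (In c l) = (b = c \<and> k \<le> l \<or> adj b c \<and> phi b c k \<le> l)"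

text \<open>The block \<open>b\<close> is the chain \<open>In b 0 < ... < In b (len b)\<close>, and \<open>col b (Suc k)\<close> is the color of
  the prime interval from \<open>In b k\<close> to \<open>In b (Suc k)\<close>. For adjacent blocks, \<open>In c (phi b c k)\<close> is
  the least element of \<open>c\<close> above \<open>In b k\<close>, to be read as \<open>Top\<close> if \<open>phi b c k > len c\<close>.
  The last two assumptions make congruences collapse everything as soon as they identify
  comparable elements of different blocks.\<close>
locale block_lattice = D: finite_nonempty_lattice D for D (structure) +
  fixes blocks :: "'b set" and len :: "'b \<Rightarrow> nat"
    and adj :: "'b \<Rightarrow> 'b \<Rightarrow> bool" and phi :: "'b \<Rightarrow> 'b \<Rightarrow> nat \<Rightarrow> nat"
    and col :: "'b \<Rightarrow> nat \<Rightarrow> 'a"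
  assumes finite_blocks: "finite blocks"
    and adj_blocks: "adj b c \<Longrightarrow> b \<in> blocks \<and> c \<in> blocks"
    and bipartite: "adj b c \<Longrightarrow> \<not> adj c d"
    and no_4_cycle: "\<lbrakk>adj b c; adj b c'; adj b' c; adj b' c'\<rbrakk> \<Longrightarrow> b = b' \<or> c = c'"
    and phi_0: "adj b c \<Longrightarrow> phi b c 0 = 0"
    and phi_mono: "\<lbrakk>adj b c; k \<le> l\<rbrakk> \<Longrightarrow> phi b c k \<le> phi b c l"
    and phi_strict: "\<lbrakk>adj b c; 0 < phi b c (Suc k)\<rbrakk> \<Longrightarrow> phi b c k < phi b c (Suc k)"
    and col_closed: "\<lbrakk>b \<in> blocks; k < len b\<rbrakk> \<Longrightarrow> col b (Suc k) \<in> carrier D"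
    and col_up: "\<lbrakk>adj b c; k < len b; col b (Suc k) \<noteq> \<top>\<rbrakk> \<Longrightarrow> phi b c (Suc k) \<le> len c \<and>
      (\<forall>m. phi b c k < m \<and> m \<le> phi b c (Suc k) \<longrightarrow> col c m \<sqsubseteq> col b (Suc k))"
    and col_down: "\<lbrakk>adj b c; k < len b; 0 < phi b c (Suc k); phi b c (Suc k) \<le> len c\<rbrakk>
      \<Longrightarrow> col b (Suc k) \<sqsubseteq> col c (phi b c (Suc k))"
    and two_below: "adj b c \<Longrightarrow> \<exists>b'. b' \<noteq> b \<and> adj b' c"
    and isolated: "\<exists>z\<in>blocks. z \<noteq> b \<and> z \<noteq> b' \<and> (\<forall>c. \<not> adj z c \<and> \<not> adj c z)"
begin

definition L :: "'b block_elem gorder" where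
  "L = \<lparr>carrier = {Bot, Top} \<union> {In b k |b k. b \<in> blocks \<and> k \<le> len b}, eq = (=),
    le = block_le adj phi\<rparr>"

lemma le_L [simp]: "x \<sqsubseteq>\<^bsub>L\<^esub> y \<longleftrightarrow> block_le adj phi x y"
  by (simp add: L_def)

lemma carrier_L [simp]: "Bot \<in> carrier L" "Top \<in> carrier L"
  "In b k \<in> carrier L \<longleftrightarrow> b \<in> blocks \<and> k \<le> len b"
  by (auto simp: L_def)

lemma adj_irrefl [simp]: "\<not> adj b b"
  using bipartite by blast

lemma block_le_Top [simp]: "block_le adj phi x Top"
  by (cases x) auto

lemma block_le_Bot [simp]: "block_le adj phi x Bot \<longleftrightarrow> x = Bot"
  by (cases x) auto

lemma block_le_refl: "block_le adj phi x x"
  by (cases x) auto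

lemma block_le_antisym: "block_le adj phi x y \<Longrightarrow> block_le adj phi y x \<Longrightarrow> x = y"
  by (cases x; cases y) (auto dest: bipartite)

lemma block_le_trans: "block_le adj phi x y \<Longrightarrow> block_le adj phi y z \<Longrightarrow> block_le adj phi x z"
  by (cases x; cases y; cases z) (auto dest: bipartite intro: le_trans phi_mono)

text \<open>Two incomparable interior elements have incomparable common upper bounds only in two
  distinct blocks adjacent to both of their blocks, which would close a 4-cycle.\<close>
lemma block_le_comparable:
  assumes "block_le adj phi x u" "block_le adj phi x v" "block_le adj phi y u" "block_le adj phi y v"
  shows "block_le adj phi x y \<or> block_le adj phi y x \<or> block_le adj phi u v \<or> block_le adj phi v u"
proof -
  consider "x = Bot \<or> x = Top \<or> y = Bot \<or> y = Top \<or> u = Bot \<or> u = Top \<or> v = Bot \<or> v = Top"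
    | b k b' k' c l c' l' where "x = In b k" "y = In b' k'" "u = In c l" "v = In c' l'"
    by (meson block_elem.exhaust)
  then show ?thesis
  proof cases
    case 1 then show ?thesis using assms by auto
  next
    case 2
    then have "b = c \<or> adj b c" "b = c' \<or> adj b c'" "b' = c \<or> adj b' c" "b' = c' \<or> adj b' c'"
      using assms by auto
    then have "b = b' \<or> c = c'" using bipartite no_4_cycle by metis
    then show ?thesis using 2 by auto
  qed
qed

sublocale L: finite_nonempty_lattice L
proof -
  interpret partial_order L
  proof
    show "x .=\<^bsub>L\<^esub> y" if "x \<sqsubseteq>\<^bsub>L\<^esub> y" "y \<sqsubseteq>\<^bsub>L\<^esub> x" for x y
      using block_le_antisym[of x y] that by (simp add: L_def)
    show "x \<sqsubseteq>\<^bsub>L\<^esub> z" if "x \<sqsubseteq>\<^bsub>L\<^esub> y" "y \<sqsubseteq>\<^bsub>L\<^esub> z" for x y z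
      using block_le_trans[of x y z] that by simp
  qed (simp_all add: L_def block_le_refl)
  have "finite ((\<lambda>(b, k). In b k) ` (SIGMA b:blocks. {..len b}))"
    using finite_blocks by (intro finite_imageI finite_SigmaI) auto
  also have "(\<lambda>(b, k). In b k) ` (SIGMA b:blocks. {..len b})
      = {In b k |b k. b \<in> blocks \<and> k \<le> len b}" by auto
  finally have "finite (carrier L)" by (simp add: L_def)
  then show "finite_nonempty_lattice L"
  proof (rule finite_lattice_of_interpolation[of Bot Top])
    fix x y u v
    assume c: "x \<in> carrier L" "y \<in> carrier L" "u \<in> carrier L" "v \<in> carrier L"
      and le: "x \<sqsubseteq>\<^bsub>L\<^esub> u" "x \<sqsubseteq>\<^bsub>L\<^esub> v" "y \<sqsubseteq>\<^bsub>L\<^esub> u" "y \<sqsubseteq>\<^bsub>L\<^esub> v"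
    then have "x \<sqsubseteq>\<^bsub>L\<^esub> y \<or> y \<sqsubseteq>\<^bsub>L\<^esub> x \<or> u \<sqsubseteq>\<^bsub>L\<^esub> v \<or> v \<sqsubseteq>\<^bsub>L\<^esub> u"
      using block_le_comparable by simp
    \<comment> \<open>The larger of \<open>x\<close> and \<open>y\<close> or the smaller of
      \<open>u\<close> and \<open>v\<close> interpolates, whichever pair is comparable.\<close>
    then show "\<exists>z\<in>carrier L. x \<sqsubseteq>\<^bsub>L\<^esub> z \<and> y \<sqsubseteq>\<^bsub>L\<^esub> z \<and> z \<sqsubseteq>\<^bsub>L\<^esub> u \<and> z \<sqsubseteq>\<^bsub>L\<^esub> v"
      using c le block_le_refl by (metis le_L)
  qed simp_all
qed

lemma phi_step_cases:
  assumes "adj b c" "k \<le> k'" "phi b c k < m" "m \<le> phi b c k'"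
  obtains i where "k \<le> i" "i < k'" "phi b c i < m" "m \<le> phi b c (Suc i)"
proof -
  have "\<exists>i. k \<le> i \<and> i < k' \<and> phi b c i < m \<and> m \<le> phi b c (Suc i)"
    using assms(2,4)
  proof (induction rule: dec_induct)
    case base then show ?case using assms(3) by simp
  next
    case (step n)
    then show ?case by (cases "m \<le> phi b c n") (auto intro: less_SucI)
  qed
  then show thesis using that by blast
qed

subsection \<open>The congruences of a block lattice\<close>

text \<open>This will be the congruence belonging to \<open>a\<close>. It stays within blocks unless
  \<open>a\<close> is the unit, where it jumps to the full congruence; \<open>min\<close> and
  \<open>max\<close> make it symmetric.\<close>

definition collapse :: "'a \<Rightarrow> ('b block_elem \<times> 'b block_elem) set" where
  "collapse a = (if a = \<top> then carrier L \<times> carrier L else Id_on (carrier L) \<union>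
    {(In b k, In b l) |b k l. b \<in> blocks \<and> k \<le> len b \<and> l \<le> len b \<and>
      (\<forall>m. min k l < m \<and> m \<le> max k l \<longrightarrow> col b m \<sqsubseteq> a)})"

lemma collapse_top: "collapse \<top> = carrier L \<times> carrier L"
  by (simp add: collapse_def)

lemma collapse_iff:
  assumes "a \<noteq> \<top>"
  shows "(x, y) \<in> collapse a \<longleftrightarrow> x = y \<and> x \<in> carrier L \<or>
    (\<exists>b k l. x = In b k \<and> y = In b l \<and> b \<in> blocks \<and> k \<le> len b \<and> l \<le> len b \<and>
      (\<forall>m. min k l < m \<and> m \<le> max k l \<longrightarrow> col b m \<sqsubseteq> a))"
  using assms by (auto simp: collapse_def)

lemma collapse_In_iff:
  assumes "a \<noteq> \<top>" "k \<le> l" "b \<in> blocks" "l \<le> len b"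
  shows "(In b k, In b l) \<in> collapse a \<longleftrightarrow> (\<forall>m. k < m \<and> m \<le> l \<longrightarrow> col b m \<sqsubseteq> a)"
  using assms by (auto simp: collapse_iff min_def max_def)

text \<open>As \<open>a\<close> is not the unit, neither is any color below it, so
  \<open>col_up\<close> applies at each step: the image never runs beyond the end of
  \<open>c\<close>, and the colors it passes are at most the color of the step.\<close>

lemma collapse_up:
  assumes a: "a \<noteq> \<top>" "a \<in> carrier D" and adj: "adj b c" and k: "k \<le> k'" "k' \<le> len b"
    and col: "\<forall>m. k < m \<and> m \<le> k' \<longrightarrow> col b m \<sqsubseteq> a" and l: "phi b c k \<le> len c"
  shows "phi b c k' \<le> len c \<and> (\<forall>m. phi b c k < m \<and> m \<le> phi b c k' \<longrightarrow> col c m \<sqsubseteq> a)"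
proof -
  have blocks: "b \<in> blocks" "c \<in> blocks" using adj_blocks[OF adj] by auto
  have step: "phi b c (Suc i) \<le> len c \<and>
      (\<forall>m. phi b c i < m \<and> m \<le> phi b c (Suc i) \<longrightarrow> col c m \<sqsubseteq> a)"
    if i: "k \<le> i" "i < k'" for i
  proof -
    have ia: "col b (Suc i) \<sqsubseteq> a" using col i by simp
    have cl: "col b (Suc i) \<in> carrier D" using col_closed blocks i k by simp
    have "col b (Suc i) \<noteq> \<top>"
      using ia a D.le_antisym[of a \<top>] by auto
    then have up: "phi b c (Suc i) \<le> len c" "\<And>m. phi b c i < m \<Longrightarrow> m \<le> phi b c (Suc i) \<Longrightarrow> col c m \<sqsubseteq> col b (Suc i)"
      using col_up[OF adj, of i] i k by auto
    moreover have "col c m \<sqsubseteq> a" if m: "phi b c i < m" "m \<le> phi b c (Suc i)" for m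
    proof -
      have "col c m \<in> carrier D" using col_closed[OF blocks(2), of "m - 1"] m up(1) by simp
      then show ?thesis using D.le_trans[OF up(2)[OF m] ia] cl a by simp
    qed
    ultimately show ?thesis by blast
  qed
  have "phi b c k' \<le> len c"
    using l step[of "k' - 1"] k by (cases "k = k'") auto
  moreover have "col c m \<sqsubseteq> a" if m: "phi b c k < m" "m \<le> phi b c k'" for m
    using phi_step_cases[OF adj k(1) m] step by metis
  ultimately show ?thesis by blast
qed

text \<open>Walk down \<open>b\<close> from \<open>k\<close> until the image is at most
  \<open>l'\<close>. Each earlier step has its upper image in the collapsed part of
  \<open>c\<close>, and \<open>col_down\<close> bounds its color by that of the prime interval
  ending there. The walk stops at 0 at the latest, by \<open>phi_0\<close>.\<close>

lemma collapse_down: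
  assumes a: "a \<in> carrier D" and adj: "adj b c" and k: "k \<le> len b" "phi b c k \<le> l"
    and l: "l' \<le> l" "l \<le> len c" and col: "\<forall>m. l' < m \<and> m \<le> l \<longrightarrow> col c m \<sqsubseteq> a"
  shows "\<exists>k'\<le>k. phi b c k' \<le> l' \<and> (\<forall>m. k' < m \<and> m \<le> k \<longrightarrow> col b m \<sqsubseteq> a)"
  using k
proof (induction k)
  case 0
  then show ?case using phi_0[OF adj] by auto
next
  case (Suc k)
  have blocks: "b \<in> blocks" "c \<in> blocks" using adj_blocks[OF adj] by auto
  show ?case
  proof (cases "phi b c (Suc k) \<le> l'")
    case True then show ?thesis by (intro exI[of _ "Suc k"]) auto
  next
    case False
    have "phi b c k \<le> l" using Suc.prems phi_mono[OF adj, of k "Suc k"] by simp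
    then obtain k' where k': "k' \<le> k" "phi b c k' \<le> l'" "\<forall>m. k' < m \<and> m \<le> k \<longrightarrow> col b m \<sqsubseteq> a"
      using Suc by auto
    have p: "0 < phi b c (Suc k)" "phi b c (Suc k) \<le> len c" using False Suc.prems l by auto
    have "col b (Suc k) \<sqsubseteq> col c (phi b c (Suc k))"
      using col_down[OF adj _ p] Suc.prems by simp
    moreover have "col c (phi b c (Suc k)) \<sqsubseteq> a" using col False Suc.prems by simp
    moreover have "col c (phi b c (Suc k)) \<in> carrier D"
      using col_closed[OF blocks(2), of "phi b c (Suc k) - 1"] p by simp
    moreover have "col b (Suc k) \<in> carrier D" using col_closed[OF blocks(1)] Suc.prems by simp
    ultimately have "col b (Suc k) \<sqsubseteq> a" using D.le_trans a by blast
    then have "\<forall>m. k' < m \<and> m \<le> Suc k \<longrightarrow> col b m \<sqsubseteq> a" using k' by (auto simp: le_Suc_eq)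
    then show ?thesis using k' by (intro exI[of _ k']) auto
  qed
qed

lemma equiv_collapse: "equiv (carrier L) (collapse a)"
proof (cases "a = \<top>")
  case True
  then show ?thesis
    by (auto simp: collapse_top intro!: equivI refl_onI symI transI)
next
  case False
  show ?thesis
  proof (rule equivI)
    show "collapse a \<subseteq> carrier L \<times> carrier L" by (auto simp: collapse_iff[OF False])
    show "refl_on (carrier L) (collapse a)" by (auto simp: refl_on_def collapse_iff[OF False])
    show "sym (collapse a)"
      by (rule symI) (auto simp: collapse_iff[OF False] min.commute max.commute)
    show "trans (collapse a)"
    proof (rule transI)
      fix x y z assume xy: "(x, y) \<in> collapse a" and yz: "(y, z) \<in> collapse a"
      show "(x, z) \<in> collapse a"
      proof (cases "x = y \<or> y = z")
        case True then show ?thesis using xy yz by auto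
      next
        case neq: False
        then obtain b k l m where *: "x = In b k" "y = In b l" "z = In b m" "b \<in> blocks"
          "k \<le> len b" "l \<le> len b" "m \<le> len b"
          and kl: "\<forall>i. min k l < i \<and> i \<le> max k l \<longrightarrow> col b i \<sqsubseteq> a"
          and lm: "\<forall>i. min l m < i \<and> i \<le> max l m \<longrightarrow> col b i \<sqsubseteq> a"
          using xy yz unfolding collapse_iff[OF False] by auto
        have "min k l < i \<and> i \<le> max k l \<or> min l m < i \<and> i \<le> max l m"
          if "min k m < i \<and> i \<le> max k m" for i
          using that by linarith
        then show ?thesis using * kl lm unfolding collapse_iff[OF False] by blast
      qed
    qed
  qed
qed

lemma congruence_collapse:
  assumes "a \<in> carrier D"
  shows "lattice_congruence L (collapse a)"
proof (cases "a = \<top>")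
  case True then show ?thesis using L.lattice_congruence_Times by (simp add: collapse_top)
next
  case False
  note iff = collapse_iff[OF False]
  note In_iff = collapse_In_iff[OF False]
  show ?thesis
  proof (rule L.congruence_of_chain_classes[OF equiv_collapse])
    fix x y assume "(x, y) \<in> collapse a"
    then show "x \<sqsubseteq>\<^bsub>L\<^esub> y \<or> y \<sqsubseteq>\<^bsub>L\<^esub> x" by (auto simp: iff block_le_refl)
  next
    fix x y z
    assume xz: "(x, z) \<in> collapse a" and le: "x \<sqsubseteq>\<^bsub>L\<^esub> y" "y \<sqsubseteq>\<^bsub>L\<^esub> z" "y \<in> carrier L"
    show "(x, y) \<in> collapse a"
    proof (cases "x = y")
      case True then show ?thesis using le by (simp add: iff)
    next
      case neq: False
      then have "x \<noteq> z" using le block_le_antisym by auto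
      then obtain b k m where *: "x = In b k" "z = In b m" "b \<in> blocks" "k \<le> len b" "m \<le> len b"
        using xz unfolding iff by auto
      obtain l where l: "y = In b l" "k \<le> l" "l \<le> m"
        using le * by (cases y) (auto dest: bipartite)
      then show ?thesis using xz * In_iff[of k m b] In_iff[of k l b] by simp
    qed
  next
    fix x x' y
    assume xx': "(x, x') \<in> collapse a" and le: "x \<sqsubseteq>\<^bsub>L\<^esub> x'" "x \<sqsubseteq>\<^bsub>L\<^esub> y" and y: "y \<in> carrier L"
    have yy: "(y, y) \<in> collapse a" using y by (simp add: iff)
    show "\<exists>y'. (y, y') \<in> collapse a \<and> x' \<sqsubseteq>\<^bsub>L\<^esub> y'"
    proof (cases "x = x' \<or> y = Top")
      case True then show ?thesis using yy le by auto
    next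
      case neq: False
      then obtain b k k' where b: "x = In b k" "x' = In b k'" "b \<in> blocks" "k' \<le> len b"
        using xx' unfolding iff by blast
      then have "k \<le> k'" using le by simp
      note * = b this
      have col: "\<forall>m. k < m \<and> m \<le> k' \<longrightarrow> col b m \<sqsubseteq> a" using In_iff[of k k' b] * xx' by simp
      obtain c l where c: "y = In c l" "c \<in> blocks" "l \<le> len c"
        using neq y le * by (cases y) auto
      \<comment> \<open>The partner of \<open>y\<close> above \<open>x'\<close> is the larger of
        \<open>y\<close> and \<open>x'\<close> within one block, and across an edge the larger of
        \<open>y\<close> and the image of \<open>x'\<close>.\<close>
      show ?thesis
      proof (cases "b = c")
        case True
        then have "k \<le> l" using le * c by simp
        then have "(y, In b (max l k')) \<in> collapse a"
          using In_iff[of l "max l k'" b] * c True col by auto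
        then show ?thesis using * by (intro exI[of _ "In b (max l k')"]) auto
      next
        case False
        then have adj: "adj b c" "phi b c k \<le> l" using le * c by auto
        have up: "phi b c k' \<le> len c" "\<forall>m. phi b c k < m \<and> m \<le> phi b c k' \<longrightarrow> col c m \<sqsubseteq> a"
          using collapse_up[OF \<open>a \<noteq> \<top>\<close> assms adj(1) *(5,4) col] adj c by auto
        then have "(y, In c (max l (phi b c k'))) \<in> collapse a"
          using In_iff[of l "max l (phi b c k')" c] c adj by auto
        then show ?thesis using * adj by (intro exI[of _ "In c (max l (phi b c k'))"]) auto
      qed
    qed
  next
    fix x y y'
    assume yy': "(y, y') \<in> collapse a" and le: "y' \<sqsubseteq>\<^bsub>L\<^esub> y" "x \<sqsubseteq>\<^bsub>L\<^esub> y" and x: "x \<in> carrier L"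
    have xx: "(x, x) \<in> collapse a" using x by (simp add: iff)
    have y'y: "(y', y) \<in> collapse a" using yy' equiv_collapse by (meson equivE symD)
    show "\<exists>x'. (x, x') \<in> collapse a \<and> x' \<sqsubseteq>\<^bsub>L\<^esub> y'"
    proof (cases "y = y' \<or> x = Bot")
      case True then show ?thesis using xx le by auto
    next
      case neq: False
      then obtain c l l' where c: "y = In c l" "y' = In c l'" "c \<in> blocks" "l \<le> len c"
        using yy' unfolding iff by blast
      then have "l' \<le> l" using le by simp
      note * = c this
      have col: "\<forall>m. l' < m \<and> m \<le> l \<longrightarrow> col c m \<sqsubseteq> a" using In_iff[of l' l c] * y'y by simp
      obtain b k where b: "x = In b k" "b \<in> blocks" "k \<le> len b"
        using neq x le * by (cases x) auto
      \<comment> \<open>The partner stays in the block of \<open>x\<close>: it is the smaller of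
        \<open>x\<close> and \<open>y'\<close> or, across an edge, the point to which
        \<open>collapse_down\<close> descends.\<close>
      have "\<exists>k'\<le>k. (In b k', x) \<in> collapse a \<and> In b k' \<sqsubseteq>\<^bsub>L\<^esub> y'"
      proof (cases "b = c")
        case True
        then have "k \<le> l" using le * b by simp
        then show ?thesis
          using In_iff[of "min k l'" k b] * b True col by (intro exI[of _ "min k l'"]) auto
      next
        case False
        then have adj: "adj b c" "phi b c k \<le> l" using le * b by auto
        obtain k' where "k' \<le> k" "phi b c k' \<le> l'" "\<forall>m. k' < m \<and> m \<le> k \<longrightarrow> col b m \<sqsubseteq> a"
          using collapse_down[OF assms adj(1) b(3) adj(2) *(5,4) col] by blast
        then show ?thesis
          using In_iff[of k' k b] b * adj by (intro exI[of _ k']) auto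
      qed
      then show ?thesis using equiv_collapse by (meson equivE symD)
    qed
  qed
qed

end

section \<open>Congruences that leave a block, and perspectivities along an edge\<close>

context block_lattice
begin

lemma full_congruence:
  assumes "lattice_congruence L \<theta>" "(Bot, Top) \<in> \<theta>"
  shows "\<theta> = collapse \<top>"
proof -
  note t = lattice_congruenceD[OF assms(1)]
  have "(Bot, x) \<in> \<theta>" if "x \<in> carrier L" for x
    using L.congruence_convex(1)[OF assms, of x] that by simp
  then have "(x, y) \<in> \<theta>" if "x \<in> carrier L" "y \<in> carrier L" for x y
    using that t(4,5) by blast
  then show ?thesis unfolding collapse_top using t(2) by blast
qed

lemma isolated_join_meet:
  assumes "z \<in> blocks" "\<forall>c. \<not> adj z c \<and> \<not> adj c z" "b \<noteq> z" "b \<in> blocks" "k \<le> len b"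
  shows "In b k \<squnion>\<^bsub>L\<^esub> In z 0 = Top" "In b k \<sqinter>\<^bsub>L\<^esub> In z 0 = Bot"
proof -
  show "In b k \<squnion>\<^bsub>L\<^esub> In z 0 = Top"
  proof (rule L.join_eqI)
    fix w assume "In b k \<sqsubseteq>\<^bsub>L\<^esub> w" "In z 0 \<sqsubseteq>\<^bsub>L\<^esub> w"
    then show "Top \<sqsubseteq>\<^bsub>L\<^esub> w" using assms by (cases w) auto
  qed (use assms in auto)
  show "In b k \<sqinter>\<^bsub>L\<^esub> In z 0 = Bot"
  proof (rule L.meet_eqI)
    fix w assume "w \<sqsubseteq>\<^bsub>L\<^esub> In b k" "w \<sqsubseteq>\<^bsub>L\<^esub> In z 0"
    then show "w \<sqsubseteq>\<^bsub>L\<^esub> Bot" using assms by (cases w) auto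
  qed (use assms in auto)
qed

text \<open>Joins with the bottoms of two isolated blocks other than \<open>b\<close> make both
  bottoms congruent to \<open>Top\<close>, and these bottoms meet in \<open>Bot\<close>. As
  \<open>b\<close> may itself be isolated, a supply of three isolated blocks is enough.\<close>

lemma full_of_Bot:
  assumes \<theta>: "lattice_congruence L \<theta>" and b: "b \<in> blocks" "k \<le> len b" "(Bot, In b k) \<in> \<theta>"
  shows "(Bot, Top) \<in> \<theta>"
proof -
  note t = lattice_congruenceD[OF \<theta>]
  obtain z where z: "z \<in> blocks" "z \<noteq> b" "\<forall>c. \<not> adj z c \<and> \<not> adj c z"
    using isolated[of b b] by blast
  obtain z' where z': "z' \<in> blocks" "z' \<noteq> b" "z' \<noteq> z" "\<forall>c. \<not> adj z' c \<and> \<not> adj c z'"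
    using isolated[of b z] by blast
  have top: "(In y 0, Top) \<in> \<theta>" if "y \<in> blocks" "y \<noteq> b" "\<forall>c. \<not> adj y c \<and> \<not> adj c y" for y
  proof -
    have "(Bot \<squnion>\<^bsub>L\<^esub> In y 0, In b k \<squnion>\<^bsub>L\<^esub> In y 0) \<in> \<theta>" using t(6)[OF b(3) t(3)] that by simp
    moreover have "Bot \<squnion>\<^bsub>L\<^esub> In y 0 = In y 0" using that by (intro L.join_absorb) auto
    ultimately show ?thesis using isolated_join_meet(1)[OF that(1,3) _ b(1,2)] that by simp
  qed
  have "(In z 0 \<sqinter>\<^bsub>L\<^esub> In z' 0, Top \<sqinter>\<^bsub>L\<^esub> Top) \<in> \<theta>"
    using t(7)[OF top[OF z] top[OF z'(1,2,4)]] .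
  moreover have "Top \<sqinter>\<^bsub>L\<^esub> Top = Top" by (intro L.meet_absorb) auto
  ultimately show ?thesis using isolated_join_meet(2)[OF z'(1,4) _ z(1), of 0] z'(3) by simp
qed

lemma full_of_Top:
  assumes \<theta>: "lattice_congruence L \<theta>" and b: "b \<in> blocks" "k \<le> len b" "(In b k, Top) \<in> \<theta>"
  shows "(Bot, Top) \<in> \<theta>"
proof -
  note t = lattice_congruenceD[OF \<theta>]
  obtain z where z: "z \<in> blocks" "z \<noteq> b" "\<forall>c. \<not> adj z c \<and> \<not> adj c z"
    using isolated[of b b] by blast
  have "(In b k \<sqinter>\<^bsub>L\<^esub> In z 0, Top \<sqinter>\<^bsub>L\<^esub> In z 0) \<in> \<theta>" using t(7)[OF b(3) t(3)] z by simp
  moreover have "Top \<sqinter>\<^bsub>L\<^esub> In z 0 = In z 0" using z by (intro L.meet_absorb2) auto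
  ultimately have "(Bot, In z 0) \<in> \<theta>" using isolated_join_meet(2)[OF z(1,3) _ b(1,2)] z by simp
  then show ?thesis by (rule full_of_Bot[OF \<theta> z(1) le0])
qed

text \<open>A second block below \<open>c\<close> exposes the pair: its bottom lies below
  \<open>In c l\<close>, because \<open>phi\<close> maps 0 to 0, but it meets \<open>In b k\<close>
  in \<open>Bot\<close>, both being lower blocks of the bipartite graph.\<close>

lemma full_of_adj:
  assumes \<theta>: "lattice_congruence L \<theta>" and adj: "adj b c"
    and car: "k \<le> len b" "l \<le> len c" and kl: "(In b k, In c l) \<in> \<theta>"
  shows "(Bot, Top) \<in> \<theta>"
proof -
  note t = lattice_congruenceD[OF \<theta>]
  obtain b' where b': "b' \<noteq> b" "adj b' c" using two_below[OF adj] by blast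
  have bl: "b \<in> blocks" "c \<in> blocks" "b' \<in> blocks" using adj_blocks adj b' by auto
  have "In b k \<sqinter>\<^bsub>L\<^esub> In b' 0 = Bot"
  proof (rule L.meet_eqI)
    fix w assume "w \<sqsubseteq>\<^bsub>L\<^esub> In b k" "w \<sqsubseteq>\<^bsub>L\<^esub> In b' 0"
    then show "w \<sqsubseteq>\<^bsub>L\<^esub> Bot"
      using b' bipartite[of _ b] bipartite[of _ b'] adj by (cases w) auto
  qed (use bl car in auto)
  moreover have "In c l \<sqinter>\<^bsub>L\<^esub> In b' 0 = In b' 0"
    using bl car b' phi_0[OF b'(2)] by (intro L.meet_absorb2) auto
  moreover have "(In b k \<sqinter>\<^bsub>L\<^esub> In b' 0, In c l \<sqinter>\<^bsub>L\<^esub> In b' 0) \<in> \<theta>"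
    using t(7)[OF kl t(3)] bl by simp
  ultimately have "(Bot, In b' 0) \<in> \<theta>" by simp
  then show ?thesis by (rule full_of_Bot[OF \<theta> bl(3) le0])
qed

lemma full_of_le:
  assumes \<theta>: "lattice_congruence L \<theta>" and xy: "(x, y) \<in> \<theta>" "x \<sqsubseteq>\<^bsub>L\<^esub> y" "x \<noteq> y"
    and neq: "\<And>b k l. x = In b k \<Longrightarrow> y \<noteq> In b l"
  shows "(Bot, Top) \<in> \<theta>"
proof -
  have c: "x \<in> carrier L" "y \<in> carrier L" using lattice_congruenceD(2)[OF \<theta>] xy by auto
  consider "x = Bot" "y = Top" | b k where "x = Bot" "y = In b k" | b k where "x = In b k" "y = Top"
    | b k c l where "x = In b k" "y = In c l" "adj b c"
    using xy neq by (cases x; cases y) auto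
  then show ?thesis
  proof cases
    case 1 then show ?thesis using xy by simp
  next
    case (2 b k) then show ?thesis using full_of_Bot[OF \<theta>, of b k] xy c by simp
  next
    case (3 b k) then show ?thesis using full_of_Top[OF \<theta>, of b k] xy c by simp
  next
    case (4 b k c' l) then show ?thesis using full_of_adj[OF \<theta> 4(3), of k l] xy c by simp
  qed
qed

lemma join_adj:
  assumes adj: "adj b c" and car: "k \<le> len b" "l \<le> len c" and l: "l \<le> phi b c k"
  shows "In b k \<squnion>\<^bsub>L\<^esub> In c l = (if phi b c k \<le> len c then In c (phi b c k) else Top)"
proof (rule L.join_eqI)
  note bl = adj_blocks[OF adj]
  show "In b k \<in> carrier L" "In c l \<in> carrier L"
    "(if phi b c k \<le> len c then In c (phi b c k) else Top) \<in> carrier L"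
    "In b k \<sqsubseteq>\<^bsub>L\<^esub> (if phi b c k \<le> len c then In c (phi b c k) else Top)"
    "In c l \<sqsubseteq>\<^bsub>L\<^esub> (if phi b c k \<le> len c then In c (phi b c k) else Top)"
    using assms bl by auto
  fix w assume w: "w \<in> carrier L" "In b k \<sqsubseteq>\<^bsub>L\<^esub> w" "In c l \<sqsubseteq>\<^bsub>L\<^esub> w"
  then have "w = Top \<or> (\<exists>m. w = In c m \<and> phi b c k \<le> m \<and> m \<le> len c)"
    using adj bipartite[OF adj] by (cases w) auto
  then show "(if phi b c k \<le> len c then In c (phi b c k) else Top) \<sqsubseteq>\<^bsub>L\<^esub> w" by auto
qed

lemma meet_adj:
  assumes adj: "adj b c" and car: "Suc k \<le> len b" "l \<le> len c"
    and l: "phi b c k \<le> l" "l < phi b c (Suc k)"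
  shows "In b (Suc k) \<sqinter>\<^bsub>L\<^esub> In c l = In b k"
proof (rule L.meet_eqI)
  note bl = adj_blocks[OF adj]
  show "In b (Suc k) \<in> carrier L" "In c l \<in> carrier L" "In b k \<in> carrier L"
    "In b k \<sqsubseteq>\<^bsub>L\<^esub> In b (Suc k)" "In b k \<sqsubseteq>\<^bsub>L\<^esub> In c l"
    using assms bl by auto
  fix w assume w: "w \<in> carrier L" "w \<sqsubseteq>\<^bsub>L\<^esub> In b (Suc k)" "w \<sqsubseteq>\<^bsub>L\<^esub> In c l"
  have "\<not> phi b c m \<le> l" if "Suc k \<le> m" for m
    using phi_mono[OF adj that] l by simp
  then have "m \<le> k" if "phi b c m \<le> l" for m using that by (meson not_less_eq_eq)
  then show "w \<sqsubseteq>\<^bsub>L\<^esub> In b k"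
    using w adj bipartite[of _ b] by (cases w) auto
qed

text \<open>Upward perspectivity, by joining with \<open>In c (phi b c k)\<close>. The image may
  consist of several prime intervals. If it runs beyond \<open>c\<close>, the join is
  \<open>Top\<close> and everything collapses; this is how a prime interval can be made to generate
  the full congruence.\<close>

lemma step_up:
  assumes \<theta>: "lattice_congruence L \<theta>" and adj: "adj b c" and k: "k < len b"
    and step: "(In b k, In b (Suc k)) \<in> \<theta>" and len: "phi b c k \<le> len c"
  shows "if phi b c (Suc k) \<le> len c then (In c (phi b c k), In c (phi b c (Suc k))) \<in> \<theta>
    else (Bot, Top) \<in> \<theta>"
proof -
  note t = lattice_congruenceD[OF \<theta>] and bl = adj_blocks[OF adj]
  let ?l = "phi b c k"
  have "(In b k \<squnion>\<^bsub>L\<^esub> In c ?l, In b (Suc k) \<squnion>\<^bsub>L\<^esub> In c ?l) \<in> \<theta>"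
    using t(6)[OF step t(3)] len bl by simp
  moreover have "In b k \<squnion>\<^bsub>L\<^esub> In c ?l = In c ?l"
    using join_adj[OF adj _ len, of k] len k by simp
  moreover have "In b (Suc k) \<squnion>\<^bsub>L\<^esub> In c ?l
      = (if phi b c (Suc k) \<le> len c then In c (phi b c (Suc k)) else Top)"
    using k phi_mono[OF adj, of k "Suc k"] by (intro join_adj[OF adj _ len]) auto
  ultimately show ?thesis using full_of_Top[OF \<theta> _ len] bl by (auto split: if_splits)
qed

text \<open>Downward perspectivity, by meeting with \<open>In b (Suc k)\<close>. By
  \<open>phi_strict\<close> the image of \<open>k\<close> is at most \<open>l\<close>, so the last
  prime interval of the image already suffices.\<close>

lemma step_down:
  assumes \<theta>: "lattice_congruence L \<theta>" and adj: "adj b c" and k: "k < len b"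
    and l: "phi b c (Suc k) = Suc l" "Suc l \<le> len c"
    and step: "(In c l, In c (Suc l)) \<in> \<theta>"
  shows "(In b k, In b (Suc k)) \<in> \<theta>"
proof -
  note t = lattice_congruenceD[OF \<theta>] and bl = adj_blocks[OF adj]
  have "(In b (Suc k) \<sqinter>\<^bsub>L\<^esub> In c l, In b (Suc k) \<sqinter>\<^bsub>L\<^esub> In c (Suc l)) \<in> \<theta>"
    using t(7)[OF t(3) step] k bl by simp
  moreover have "In b (Suc k) \<sqinter>\<^bsub>L\<^esub> In c l = In b k"
    using meet_adj[OF adj, of k l] k l phi_strict[OF adj, of k] by simp
  moreover have "In b (Suc k) \<sqinter>\<^bsub>L\<^esub> In c (Suc l) = In b (Suc k)"
    using bl k l adj by (intro L.meet_absorb) auto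
  ultimately show ?thesis by simp
qed

lemma steps_convex:
  assumes \<theta>: "lattice_congruence L \<theta>" and b: "b \<in> blocks" "k \<le> l" "l \<le> len b"
  shows "(In b k, In b l) \<in> \<theta> \<longleftrightarrow> (\<forall>m. k \<le> m \<and> m < l \<longrightarrow> (In b m, In b (Suc m)) \<in> \<theta>)"
proof
  assume kl: "(In b k, In b l) \<in> \<theta>"
  show "\<forall>m. k \<le> m \<and> m < l \<longrightarrow> (In b m, In b (Suc m)) \<in> \<theta>"
  proof (intro allI impI)
    fix m assume m: "k \<le> m \<and> m < l"
    have "(In b m, In b l) \<in> \<theta>"
      using L.congruence_convex(2)[OF \<theta> kl, of "In b m"] m b by simp
    then show "(In b m, In b (Suc m)) \<in> \<theta>"
      using L.congruence_convex(1)[OF \<theta>, of "In b m" "In b l" "In b (Suc m)"] m b by simp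
  qed
next
  note t = lattice_congruenceD[OF \<theta>]
  assume "\<forall>m. k \<le> m \<and> m < l \<longrightarrow> (In b m, In b (Suc m)) \<in> \<theta>"
  with b(2,3) show "(In b k, In b l) \<in> \<theta>"
  proof (induction rule: dec_induct)
    case base then show ?case using t(3) b by simp
  next
    case (step n)
    then have "(In b k, In b n) \<in> \<theta>" "(In b n, In b (Suc n)) \<in> \<theta>" by auto
    then show ?case by (rule t(5))
  qed
qed

text \<open>A congruence other than the full one never identifies distinct comparable elements that
  lack a common block, so it is determined by the prime intervals inside the blocks.\<close>

lemma congruence_eq_collapse:
  assumes \<theta>: "lattice_congruence L \<theta>" and full: "(Bot, Top) \<notin> \<theta>" and a: "a \<in> carrier D" "a \<noteq> \<top>"
    and steps: "\<And>b k. b \<in> blocks \<Longrightarrow> k < len b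
      \<Longrightarrow> (In b k, In b (Suc k)) \<in> \<theta> \<longleftrightarrow> col b (Suc k) \<sqsubseteq> a"
  shows "\<theta> = collapse a"
proof -
  have same: "(In b k, In b l) \<in> \<theta> \<longleftrightarrow> (In b k, In b l) \<in> collapse a"
    if "b \<in> blocks" "k \<le> l" "l \<le> len b" for b k l
  proof -
    have "(In b k, In b l) \<in> \<theta> \<longleftrightarrow> (\<forall>m. k \<le> m \<and> m < l \<longrightarrow> col b (Suc m) \<sqsubseteq> a)"
      using steps_convex[OF \<theta> that] steps that by simp
    also have "\<dots> \<longleftrightarrow> (\<forall>m. k < m \<and> m \<le> l \<longrightarrow> col b m \<sqsubseteq> a)"
      by (metis Suc_le_eq less_Suc_eq_le less_eq_Suc_le not_less_eq_eq Suc_le_D Suc_le_mono)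
    finally show ?thesis using collapse_In_iff[OF a(2) that(2,1,3)] by simp
  qed
  have le: "(x, y) \<in> \<theta> \<longleftrightarrow> (x, y) \<in> collapse a"
    if le: "x \<sqsubseteq>\<^bsub>L\<^esub> y" and c: "x \<in> carrier L" "y \<in> carrier L" for x y
  proof (cases "x = y")
    case True
    then show ?thesis
      using lattice_congruenceD(3)[OF \<theta>] lattice_congruenceD(3)[OF congruence_collapse[OF a(1)]] c by simp
  next
    case neq: False
    show ?thesis
    proof (cases "\<exists>b k l. x = In b k \<and> y = In b l")
      case True
      then show ?thesis using same le c by auto
    next
      case False
      then have "(x, y) \<notin> \<theta>" using full_of_le[OF \<theta> _ le neq] full by blast
      moreover have "(x, y) \<notin> collapse a" using False neq by (auto simp: collapse_iff[OF a(2)])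
      ultimately show ?thesis by simp
    qed
  qed
  have "(x, y) \<in> \<theta> \<longleftrightarrow> (x, y) \<in> collapse a" if c: "x \<in> carrier L" "y \<in> carrier L" for x y
    using L.congruence_meet_join_iff[OF \<theta> c] L.congruence_meet_join_iff[OF congruence_collapse[OF a(1)] c]
      le[of "x \<sqinter>\<^bsub>L\<^esub> y" "x \<squnion>\<^bsub>L\<^esub> y"] L.le_trans[OF L.meet_left[OF c] L.join_left[OF c]] c by simp
  then show ?thesis
    using lattice_congruenceD(2)[OF \<theta>] lattice_congruenceD(2)[OF congruence_collapse[OF a(1)]] by blast
qed

end

text \<open>\<open>color_congruence\<close> isolates what a particular graph has to provide: in a
  proper congruence, whether a prime interval of a block is collapsed depends on its color only, and
  the collapsed colors form a down-set without the unit.\<close>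

locale representing_block_lattice = D: finite_distributive_lattice D +
  block_lattice D blocks len adj phi col for D (structure)
    and blocks :: "'b set" and len adj phi and col :: "'b \<Rightarrow> nat \<Rightarrow> 'a" +
  assumes top_irreducible: "\<top> \<in> join_irreducibles D"
    and col_irreducible: "\<lbrakk>b \<in> blocks; k < len b\<rbrakk> \<Longrightarrow> col b (Suc k) \<in> join_irreducibles D"
    and col_surj: "p \<in> join_irreducibles D \<Longrightarrow> \<exists>b\<in>blocks. \<exists>k<len b. col b (Suc k) = p"
    and color_congruence: "\<lbrakk>lattice_congruence L \<theta>; (Bot, Top) \<notin> \<theta>\<rbrakk> \<Longrightarrow>
      \<exists>A\<subseteq>join_irreducibles D. \<top> \<notin> A \<and>
        (\<forall>p\<in>A. \<forall>q\<in>join_irreducibles D. q \<sqsubseteq> p \<longrightarrow> q \<in> A) \<and>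
        (\<forall>b\<in>blocks. \<forall>k<len b. (In b k, In b (Suc k)) \<in> \<theta> \<longleftrightarrow> col b (Suc k) \<in> A)"
begin

text \<open>The element is the join of the collapsed colors. These form a down-set and colors are
  join-prime, so the colors below the join are exactly the collapsed ones.\<close>

lemma collapse_surj:
  assumes \<theta>: "lattice_congruence L \<theta>"
  shows "\<exists>a\<in>carrier D. \<theta> = collapse a"
proof (cases "(Bot, Top) \<in> \<theta>")
  case True then show ?thesis using full_congruence[OF \<theta>] by blast
next
  case False
  from color_congruence[OF \<theta> False] obtain A where A: "A \<subseteq> join_irreducibles D" "\<top> \<notin> A"
    "\<forall>p\<in>A. \<forall>q\<in>join_irreducibles D. q \<sqsubseteq> p \<longrightarrow> q \<in> A"
    "\<forall>b\<in>blocks. \<forall>k<len b. (In b k, In b (Suc k)) \<in> \<theta> \<longleftrightarrow> col b (Suc k) \<in> A"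
    by (elim exE conjE) (rule that)
  have Ac: "A \<subseteq> carrier D" using A(1) D.join_irreducible_carrier by blast
  have mem: "p \<in> A \<longleftrightarrow> p \<sqsubseteq> \<Squnion> A" if p: "p \<in> join_irreducibles D" for p
  proof
    assume "p \<in> A" then show "p \<sqsubseteq> \<Squnion> A" using D.sup_upper[OF Ac] by blast
  next
    assume "p \<sqsubseteq> \<Squnion> A"
    then show "p \<in> A" using D.join_irreducible_le_sup[OF p Ac] A(3) p by blast
  qed
  have c: "\<Squnion> A \<in> carrier D" using Ac by simp
  \<comment> \<open>Otherwise the unit, itself join-irreducible, would be among the collapsed
    colors. This keeps \<open>collapse\<close> of the join away from the full congruence.\<close>
  have "\<Squnion> A \<noteq> \<top>" using mem[OF top_irreducible] A(2) c by auto
  then have "\<theta> = collapse (\<Squnion> A)"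
    by (rule congruence_eq_collapse[OF \<theta> False c]) (simp add: A(4) mem[symmetric] col_irreducible)
  then show ?thesis using c by blast
qed

text \<open>If \<open>a\<close> is not below \<open>a'\<close>, some join-irreducible
  \<open>j\<close> is below \<open>a\<close> but not below \<open>a'\<close>, and a prime interval
  of color \<open>j\<close> tells the congruences apart.\<close>

lemma collapse_subset_iff:
  assumes "a \<in> carrier D" "a' \<in> carrier D"
  shows "collapse a \<subseteq> collapse a' \<longleftrightarrow> a \<sqsubseteq> a'"
proof
  assume sub: "collapse a \<subseteq> collapse a'"
  show "a \<sqsubseteq> a'"
  proof (rule ccontr)
    assume neg: "\<not> a \<sqsubseteq> a'"
    then have a': "a' \<noteq> \<top>" using assms by auto
    obtain j where j: "j \<in> join_irreducibles D" "j \<sqsubseteq> a" "\<not> j \<sqsubseteq> a'"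
      using D.join_irreducible_separates[OF assms neg] by blast
    obtain b k where b: "b \<in> blocks" "k < len b" "col b (Suc k) = j" using col_surj[OF j(1)] by blast
    have m: "(\<forall>m. k < m \<and> m \<le> Suc k \<longrightarrow> P m) \<longleftrightarrow> P (Suc k)" for P
      by (metis Suc_leI le_antisym lessI order_refl)
    have "(In b k, In b (Suc k)) \<in> collapse a"
    proof (cases "a = \<top>")
      case True then show ?thesis using b by (simp add: collapse_top)
    next
      case False
      then show ?thesis using b j collapse_In_iff[OF False, of k "Suc k" b] by (simp add: m)
    qed
    then have "(In b k, In b (Suc k)) \<in> collapse a'" using sub by blast
    then show False using b j collapse_In_iff[OF a', of k "Suc k" b] by (simp add: m)
  qed
next
  assume le: "a \<sqsubseteq> a'"
  show "collapse a \<subseteq> collapse a'"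
  proof (cases "a' = \<top>")
    case True
    then show ?thesis
      using lattice_congruenceD(2)[OF congruence_collapse[OF assms(1)]] by (simp add: collapse_top)
  next
    case False
    then have a: "a \<noteq> \<top>" using le assms D.le_antisym[of a' \<top>] by auto
    show ?thesis
    proof (rule subrelI)
      fix x y assume "(x, y) \<in> collapse a"
      then consider "x = y" "x \<in> carrier L" | b k l where "x = In b k" "y = In b l" "b \<in> blocks"
        "k \<le> len b" "l \<le> len b" "\<forall>m. min k l < m \<and> m \<le> max k l \<longrightarrow> col b m \<sqsubseteq> a"
        unfolding collapse_iff[OF a] by blast
      then show "(x, y) \<in> collapse a'"
      proof cases
        case 1 then show ?thesis by (simp add: collapse_iff[OF False])
      next
        case (2 b k l)
        have "col b m \<sqsubseteq> a'" if m: "min k l < m \<and> m \<le> max k l" for m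
        proof -
          have "0 < m" "m \<le> len b" using m 2(4,5) by auto
          then have "col b m \<in> carrier D" using col_closed[OF 2(3), of "m - 1"] by simp
          then show ?thesis using D.le_trans[OF _ le] 2(6) m assms by blast
        qed
        then show ?thesis using 2 unfolding collapse_iff[OF False] by blast
      qed
    qed
  qed
qed

lemma lattice_isomorphism_collapse: "lattice_isomorphism D (Con L) collapse"
proof (rule order_isomorphism_imp_lattice_isomorphism[OF D.lattice_axioms partial_order_Con])
  have "inj_on collapse (carrier D)"
  proof (rule inj_onI)
    fix a a' assume a: "a \<in> carrier D" "a' \<in> carrier D" "collapse a = collapse a'"
    then have "a \<sqsubseteq> a'" "a' \<sqsubseteq> a"
      using collapse_subset_iff[OF a(1,2)] collapse_subset_iff[OF a(2,1)] by simp_all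
    then show "a = a'" using a(1,2) by (rule D.le_antisym)
  qed
  moreover have "collapse ` carrier D = carrier (Con L)"
  proof (intro equalityI subsetI)
    fix \<theta> assume "\<theta> \<in> carrier (Con L)"
    then show "\<theta> \<in> collapse ` carrier D" using collapse_surj[of \<theta>] by auto
  qed (auto simp: congruence_collapse)
  ultimately show "bij_betw collapse (carrier D) (carrier (Con L))" by (simp add: bij_betw_def)
qed (simp add: collapse_subset_iff)

text \<open>Every congruence is some \<open>collapse a\<close>, so the generated one belongs to the
  least \<open>a\<close> for which the pair is identified.\<close>

lemma con_eq_collapse:
  assumes "x \<in> carrier L" "y \<in> carrier L" "d \<in> carrier D"
    and "\<And>a. a \<in> carrier D \<Longrightarrow> (x, y) \<in> collapse a \<longleftrightarrow> d \<sqsubseteq> a"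
  shows "con L x y = collapse d"
proof
  show "con L x y \<subseteq> collapse d"
    using L.con_subset_iff[OF assms(1,2) congruence_collapse[OF assms(3)]] assms by simp
  obtain a where a: "a \<in> carrier D" "con L x y = collapse a"
    using collapse_surj[OF L.con_congruence(1)[OF assms(1,2)]] by blast
  then have "d \<sqsubseteq> a" using assms(4) L.con_congruence(2)[OF assms(1,2)] by simp
  then show "collapse d \<subseteq> con L x y" using a collapse_subset_iff assms(3) by simp
qed

lemma con_In:
  assumes "b \<in> blocks" "k \<le> l" "l \<le> len b"
  shows "con L (In b k) (In b l) = collapse (\<Squnion> (col b ` {k<..l}))"
proof (rule con_eq_collapse)
  have c: "col b ` {k<..l} \<subseteq> carrier D"
  proof
    fix p assume "p \<in> col b ` {k<..l}"
    then obtain m where "k < m" "m \<le> l" "p = col b m" by auto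
    then show "p \<in> carrier D" using col_closed[OF assms(1), of "m - 1"] assms by simp
  qed
  then show "\<Squnion> (col b ` {k<..l}) \<in> carrier D" by simp
  fix a assume a: "a \<in> carrier D"
  show "(In b k, In b l) \<in> collapse a \<longleftrightarrow> \<Squnion> (col b ` {k<..l}) \<sqsubseteq> a"
  proof (cases "a = \<top>")
    case True then show ?thesis using assms c by (simp add: collapse_top)
  next
    case False
    then show ?thesis
      using collapse_In_iff[OF False assms(2,1,3)] D.sup_le_iff[OF c a] by auto
  qed
qed (use assms in auto)

lemma con_different_blocks:
  assumes "x \<in> carrier L" "y \<in> carrier L" "x \<sqsubseteq>\<^bsub>L\<^esub> y" "x \<noteq> y"
    and "\<And>b k l. x = In b k \<Longrightarrow> y \<noteq> In b l"
  shows "con L x y = collapse \<top>"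
  using full_congruence full_of_le[OF _ _ assms(3,4)] assms(5) L.con_congruence[OF assms(1,2)] by blast

lemma Princ_L:
  "Princ L = collapse ` ({\<top>} \<union> {\<Squnion> (col b ` {k<..l}) |b k l. b \<in> blocks \<and> k \<le> l \<and> l \<le> len b})"
proof (intro equalityI subsetI)
  fix \<theta> assume "\<theta> \<in> Princ L"
  then obtain x y where xy: "x \<in> carrier L" "y \<in> carrier L" "x \<sqsubseteq>\<^bsub>L\<^esub> y" "\<theta> = con L x y"
    unfolding L.Princ_eq by blast
  obtain z where z: "z \<in> blocks" using isolated by blast
  consider b k l where "x = In b k" "y = In b l" | "x = y"
    | "x \<noteq> y" "\<And>b k l. x = In b k \<Longrightarrow> y \<noteq> In b l" by metis
  then show "\<theta> \<in> collapse ` ({\<top>} \<union> {\<Squnion> (col b ` {k<..l}) |b k l. b \<in> blocks \<and> k \<le> l \<and> l \<le> len b})"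
  proof cases
    case (1 b k l)
    then have "b \<in> blocks" "k \<le> l" "l \<le> len b" using xy by auto
    then show ?thesis using con_In[of b k l] 1 xy by blast
  next
    case 2
    \<comment> \<open>The element may be \<open>Bot\<close> or \<open>Top\<close>, which lie in no
      block; the zero congruence is therefore written with a one-point interval of some block, whose
      join is empty.\<close>
    have "con L x y = con L (In z 0) (In z 0)"
      using L.con_subset_iff[of x x "con L (In z 0) (In z 0)"]
        L.con_subset_iff[of "In z 0" "In z 0" "con L x x"] L.con_congruence(1)
        lattice_congruenceD(3)[OF L.con_congruence(1)] xy z 2 by simp
    also have "\<dots> = collapse (\<Squnion> (col z ` {0<..0}))" using con_In[of z 0 0] z by simp
    finally show ?thesis using xy z by blast
  next
    case 3
    then show ?thesis using con_different_blocks[OF xy(1-3)] xy by simp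
  qed
next
  fix \<theta> assume "\<theta> \<in> collapse ` ({\<top>} \<union> {\<Squnion> (col b ` {k<..l}) |b k l. b \<in> blocks \<and> k \<le> l \<and> l \<le> len b})"
  then consider "\<theta> = collapse \<top>"
    | b k l where "b \<in> blocks" "k \<le> l" "l \<le> len b" "\<theta> = collapse (\<Squnion> (col b ` {k<..l}))" by blast
  then show "\<theta> \<in> Princ L"
  proof cases
    case 1
    have "con L Bot Top = collapse \<top>" by (rule con_different_blocks) auto
    then show ?thesis using 1 unfolding Princ_def by (metis (mono_tags, lifting) carrier_L(1,2) mem_Collect_eq)
  next
    case (2 b k l)
    then have "\<theta> = con L (In b k) (In b l)" "In b k \<in> carrier L" "In b l \<in> carrier L"
      using con_In[of b k l] by auto
    then show ?thesis unfolding Princ_def by blast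
  qed
qed

end

subsection \<open>The block lattice of a word of colors\<close>

text \<open>\<open>Chain\<close> carries the word and \<open>Row i\<close> a copy of its initial segment of length \<open>i\<close>. The last
  prime interval of \<open>Row (Suc i)\<close> is projective, via \<open>Tip i\<close>, to \<open>Color (cs ! i)\<close>; for the unit color
  \<open>Tip i\<close> is one element short, so that collapsing the interval identifies \<open>Tip i\<close> with \<open>Top\<close>.
  Above \<open>Color p\<close> and \<open>Color q\<close> with \<open>q < p\<close>, \<open>Link p q\<close> has colors \<open>q\<close>, \<open>p\<close>; its full length is
  perspective to \<open>Color p\<close> and its first interval to \<open>Color q\<close>. The blocks \<open>Iso i\<close> are complements
  of everything else.\<close>
datatype 'a color_block = Chain | Row nat | Tip nat | Color 'a | Link 'a 'a | Iso nat

text \<open>Truncated subtraction sends all but the last element of \<open>Row (Suc i)\<close> to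
  the bottom of \<open>Tip i\<close>, so that only the last prime interval moves up. Doubling sends
  \<open>Color p\<close> to the ends of \<open>Link p q\<close>, while \<open>Color q\<close> is
  sent to its lower half.\<close>

fun color_phi :: "'a color_block \<Rightarrow> 'a color_block \<Rightarrow> nat \<Rightarrow> nat" where
  "color_phi (Row i) (Tip j) k = k - j"
| "color_phi (Color p) (Link q r) k = (if p = q then 2 * k else k)"
| "color_phi b c k = k"

lemma sublist_image:
  assumes "k \<le> l" "l \<le> length cs"
  shows "(\<lambda>m. cs ! (m - 1)) ` {k<..l} = set (take (l - k) (drop k cs))"
proof -
  have "take (l - k) (drop k cs) = map (\<lambda>i. cs ! i) [k..<l]"
    using assms by (intro nth_equalityI) auto
  moreover have "{k<..l} = Suc ` {k..<l}" by auto
  ultimately show ?thesis by (simp only: image_image set_map set_upt diff_Suc_1)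
qed

locale colored_word = finite_distributive_lattice D for D (structure) +
  fixes cs :: "'a list"
  assumes set_cs: "set cs = join_irreducibles D"
    and top_in_cs: "\<top> \<in> set cs"
begin

text \<open>\<open>Row 0\<close> supplies a second block below \<open>Chain\<close> when the word
  has a single letter. Three \<open>Iso\<close> blocks leave one free when two blocks are to be
  avoided.\<close>

definition color_blocks :: "'a color_block set" where
  "color_blocks = {Chain} \<union> Row ` {..length cs} \<union> Tip ` {..<length cs} \<union> Color ` set cs \<union>
    (\<lambda>(p, q). Link p q) ` {(p, q) \<in> set cs \<times> set cs. q \<sqsubset> p} \<union> Iso ` {..<3}"

fun color_len :: "'a color_block \<Rightarrow> nat" where
  "color_len Chain = length cs"
| "color_len (Row i) = i"
| "color_len (Tip i) = (if cs ! i = \<top> then 0 else 1)"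
| "color_len (Color p) = 1"
| "color_len (Link p q) = 2"
| "color_len (Iso i) = 0"

text \<open>The index \<open>m\<close> names the prime interval by its upper end, hence the letter
  at \<open>m - 1\<close>.\<close>

fun color_col :: "'a color_block \<Rightarrow> nat \<Rightarrow> 'a" where
  "color_col Chain m = cs ! (m - 1)"
| "color_col (Row i) m = cs ! (m - 1)"
| "color_col (Tip i) m = cs ! i"
| "color_col (Color p) m = p"
| "color_col (Link p q) m = (if m = 1 then q else p)"
| "color_col (Iso i) m = \<bottom>"

inductive color_adj :: "'a color_block \<Rightarrow> 'a color_block \<Rightarrow> bool" where
  Row_Chain: "i \<le> length cs \<Longrightarrow> color_adj (Row i) Chain"
| Row_Tip: "i < length cs \<Longrightarrow> color_adj (Row (Suc i)) (Tip i)"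
| Color_Tip: "i < length cs \<Longrightarrow> p = cs ! i \<Longrightarrow> color_adj (Color p) (Tip i)"
| Color_Link1: "p \<in> set cs \<Longrightarrow> q \<in> set cs \<Longrightarrow> q \<sqsubset> p \<Longrightarrow> color_adj (Color p) (Link p q)"
| Color_Link2: "p \<in> set cs \<Longrightarrow> q \<in> set cs \<Longrightarrow> q \<sqsubset> p \<Longrightarrow> color_adj (Color q) (Link p q)"

lemma cs_carrier: "p \<in> set cs \<Longrightarrow> p \<in> carrier D"
  using set_cs join_irreducible_carrier by blast

lemma lless_asym: "p \<in> set cs \<Longrightarrow> q \<in> set cs \<Longrightarrow> p \<sqsubset> q \<Longrightarrow> \<not> q \<sqsubset> p"
  using cs_carrier le_antisym[of p q] by (auto simp: lless_eq)

inductive_cases adj_Row: "color_adj (Row i) c"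
inductive_cases adj_Color: "color_adj (Color p) c"
inductive_cases adj_ChainE: "color_adj b Chain"
inductive_cases adj_TipE: "color_adj b (Tip i)"
inductive_cases adj_LinkE: "color_adj b (Link p q)"

lemma block_lattice_color:
  "block_lattice D color_blocks color_len color_adj color_phi color_col"
proof
  have "finite {(p, q) \<in> set cs \<times> set cs. q \<sqsubset> p}"
    by (rule finite_subset[of _ "set cs \<times> set cs"]) auto
  then show "finite color_blocks" by (simp add: color_blocks_def)
  fix b c c' b' d :: "'a color_block" and k l :: nat
  show "color_adj b c \<Longrightarrow> b \<in> color_blocks \<and> c \<in> color_blocks"
    by (erule color_adj.cases) (auto simp: color_blocks_def)
  show "color_adj b c \<Longrightarrow> \<not> color_adj c d"
    by (auto elim!: color_adj.cases)
  \<comment> \<open>Two rows share only \<open>Chain\<close>; a row and a color share at most one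
    \<open>Tip\<close>; two colors share at most one \<open>Link\<close>, because \<open>p\<close>
    and \<open>q\<close> cannot lie strictly below each other.\<close>
  show "b = b' \<or> c = c'" if "color_adj b c" "color_adj b c'" "color_adj b' c" "color_adj b' c'"
    using that(1)
  proof cases
    case (Row_Chain i)
    then show ?thesis using that by (auto elim!: adj_Row adj_ChainE adj_TipE)
  next
    case (Row_Tip i)
    then show ?thesis using that by (auto elim!: adj_Row adj_ChainE adj_TipE adj_Color)
  next
    case (Color_Tip i)
    then show ?thesis using that by (auto elim!: adj_Row adj_ChainE adj_TipE adj_Color adj_LinkE)
  next
    case (Color_Link1 p q)
    then show ?thesis using that lless_asym[of p q]
      by (auto elim!: adj_TipE adj_Color adj_LinkE)
  next
    case (Color_Link2 p q)
    then show ?thesis using that lless_asym[of p q]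
      by (auto elim!: adj_TipE adj_Color adj_LinkE)
  qed
  show "color_adj b c \<Longrightarrow> color_phi b c 0 = 0"
    by (erule color_adj.cases) auto
  show "color_adj b c \<Longrightarrow> k \<le> l \<Longrightarrow> color_phi b c k \<le> color_phi b c l"
    by (erule color_adj.cases) auto
  show "color_adj b c \<Longrightarrow> 0 < color_phi b c (Suc k) \<Longrightarrow> color_phi b c k < color_phi b c (Suc k)"
    by (erule color_adj.cases) auto
  show "b \<in> color_blocks \<Longrightarrow> k < color_len b \<Longrightarrow> color_col b (Suc k) \<in> carrier D"
    by (cases b) (auto simp: color_blocks_def intro!: cs_carrier split: if_splits)
  show "color_phi b c (Suc k) \<le> color_len c \<and>
      (\<forall>m. color_phi b c k < m \<and> m \<le> color_phi b c (Suc k) \<longrightarrow> color_col c m \<sqsubseteq> color_col b (Suc k))"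
    if "color_adj b c" "k < color_len b" "color_col b (Suc k) \<noteq> \<top>"
    using that(1)
  proof cases
    case (Row_Chain i)
    have "m = Suc k" if "k < m" "m \<le> Suc k" for m using that by simp
    then show ?thesis using Row_Chain that(2) cs_carrier[of "cs ! k"] by (auto simp: le_Suc_eq)
  next
    case (Row_Tip i)
    then show ?thesis using that(2,3) cs_carrier[of "cs ! i"] by (auto simp: less_Suc_eq)
  next
    case (Color_Tip i)
    then show ?thesis using that(2,3) cs_carrier[of "cs ! i"] by auto
  next
    \<comment> \<open>The image is the whole \<open>Link\<close>, whose colors \<open>q\<close> and
      \<open>p\<close> are both at most \<open>p\<close>.\<close>
    case (Color_Link1 p q)
    then show ?thesis using that(2) cs_carrier[of p] by (auto simp: lless_eq)
  next
    case (Color_Link2 p q)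
    have "m = Suc 0" if "0 < m" "m \<le> Suc 0" for m using that by simp
    then show ?thesis
      using Color_Link2 that(2) cs_carrier[of q] cs_carrier[of p] by (auto simp: lless_eq)
  qed
  show "color_col b (Suc k) \<sqsubseteq> color_col c (color_phi b c (Suc k))"
    if "color_adj b c" "k < color_len b" "0 < color_phi b c (Suc k)" "color_phi b c (Suc k) \<le> color_len c"
    using that(1)
  proof cases
    case (Row_Chain i)
    then show ?thesis using that(2) cs_carrier[of "cs ! k"] by simp
  next
    case (Row_Tip i)
    \<comment> \<open>The lower steps of the row have image 0.\<close>
    then have "k = i" using that(2,3) by simp
    then show ?thesis using Row_Tip cs_carrier[of "cs ! i"] by simp
  next
    case (Color_Tip i)
    then show ?thesis using cs_carrier[of "cs ! i"] by simp
  next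
    case (Color_Link1 p q)
    then show ?thesis using that(2) cs_carrier[of p] by simp
  next
    case (Color_Link2 p q)
    then show ?thesis using that(2) cs_carrier[of q] by (auto simp: lless_eq)
  qed
  show "\<exists>b'. b' \<noteq> b \<and> color_adj b' c" if "color_adj b c"
    using that
  proof cases
    case (Row_Chain i)
    have "0 < length cs" using top_in_cs by auto
    then have "color_adj (Row 0) Chain" "color_adj (Row 1) Chain"
      by (auto intro: color_adj.Row_Chain simp: Suc_le_eq)
    then show ?thesis using Row_Chain by (metis color_block.inject(1) zero_neq_one)
  next
    case (Row_Tip i)
    then show ?thesis using color_adj.Color_Tip by blast
  next
    case (Color_Tip i)
    then show ?thesis using color_adj.Row_Tip by blast
  next
    case (Color_Link1 p q)
    then have "color_adj (Color q) c" "q \<noteq> p" using color_adj.Color_Link2 by (auto simp: lless_eq)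
    then show ?thesis using Color_Link1(1) by (intro exI[of _ "Color q"]) auto
  next
    case (Color_Link2 p q)
    then have "color_adj (Color p) c" "q \<noteq> p" using color_adj.Color_Link1 by (auto simp: lless_eq)
    then show ?thesis using Color_Link2(1) by (intro exI[of _ "Color p"]) auto
  qed
  have iso: "Iso i \<in> color_blocks" if "i < 3" for i
    using that by (simp add: color_blocks_def)
  have no_adj: "\<not> color_adj (Iso i) d" "\<not> color_adj d (Iso i)" for i d
    by (auto elim!: color_adj.cases)
  have "\<exists>i<3. Iso i \<noteq> b \<and> Iso i \<noteq> b'"
  proof -
    have "Iso 0 \<noteq> b \<and> Iso 0 \<noteq> b' \<or> Iso 1 \<noteq> b \<and> Iso 1 \<noteq> b' \<or> Iso 2 \<noteq> b \<and> Iso 2 \<noteq> b'" by auto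
    moreover have "0 < (3 :: nat)" "1 < (3 :: nat)" "2 < (3 :: nat)" by auto
    ultimately show ?thesis by blast
  qed
  then show "\<exists>z\<in>color_blocks. z \<noteq> b \<and> z \<noteq> b' \<and> (\<forall>c. \<not> color_adj z c \<and> \<not> color_adj c z)"
    using iso no_adj by blast
qed

sublocale block_lattice D color_blocks color_len color_adj color_phi color_col
  by (rule block_lattice_color)

section \<open>Collapsed colors and principal congruences of the lattice of a word\<close>

lemma color_col_irreducible:
  assumes "b \<in> color_blocks" "k < color_len b"
  shows "color_col b (Suc k) \<in> set cs"
  using assms by (cases b) (auto simp: color_blocks_def split: if_splits)

text \<open>The collapsed colors are read off at the \<open>Color\<close> blocks and carried along
  perspectivities: from \<open>Color (cs ! k)\<close> through \<open>Tip k\<close> to the last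
  interval of \<open>Row (Suc k)\<close>, on to its counterpart in \<open>Chain\<close>, and from
  there to all longer rows. The \<open>Link\<close> blocks make the set a down-set.\<close>

lemma color_steps:
  assumes \<theta>: "lattice_congruence L \<theta>" and full: "(Bot, Top) \<notin> \<theta>"
  defines "A \<equiv> {p \<in> set cs. (In (Color p) 0, In (Color p) (Suc 0)) \<in> \<theta>}"
  shows "\<top> \<notin> A" "\<forall>p\<in>A. \<forall>q\<in>set cs. q \<sqsubseteq> p \<longrightarrow> q \<in> A"
    and "\<forall>b\<in>color_blocks. \<forall>k<color_len b. (In b k, In b (Suc k)) \<in> \<theta> \<longleftrightarrow> color_col b (Suc k) \<in> A"
proof -
  note up = step_up[OF \<theta>] and down = step_down[OF \<theta>]
  obtain t where t: "t < length cs" "cs ! t = \<top>" using top_in_cs by (auto simp: in_set_conv_nth)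
  have color: "p \<in> A \<longleftrightarrow> (In (Color p) 0, In (Color p) (Suc 0)) \<in> \<theta>" if "p \<in> set cs" for p
    using that by (simp add: A_def)
  show top: "\<top> \<notin> A"
  proof
    assume "\<top> \<in> A"
    \<comment> \<open>\<open>Tip t\<close> is a single point, so moving up along this edge reaches
      \<open>Top\<close>.\<close>
    then show False
      using up[OF color_adj.Color_Tip[OF t(1)], of \<top> 0] t color[of \<top>] top_in_cs full by simp
  qed
  have tip: "(In (Tip i) 0, In (Tip i) (Suc 0)) \<in> \<theta> \<longleftrightarrow> cs ! i \<in> A"
    if i: "i < length cs" "cs ! i \<noteq> \<top>" for i
    using up[OF color_adj.Color_Tip[OF i(1) HOL.refl], of 0]
      down[OF color_adj.Color_Tip[OF i(1) HOL.refl], of 0 0] i color[of "cs ! i"] by auto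
  have row_last: "(In (Row (Suc i)) i, In (Row (Suc i)) (Suc i)) \<in> \<theta> \<longleftrightarrow> cs ! i \<in> A"
    if i: "i < length cs" for i
  proof (cases "cs ! i = \<top>")
    \<comment> \<open>Neither side holds: the row interval would move up to \<open>Top\<close>,
      since this \<open>Tip\<close> is a single point.\<close>
    case True
    then show ?thesis using up[OF color_adj.Row_Tip[OF i], of i] top full by auto
  next
    case False
    then show ?thesis
      using up[OF color_adj.Row_Tip[OF i], of i] down[OF color_adj.Row_Tip[OF i], of i 0] tip[OF i]
      by auto
  qed
  have row: "(In (Row i) k, In (Row i) (Suc k)) \<in> \<theta> \<longleftrightarrow> (In Chain k, In Chain (Suc k)) \<in> \<theta>"
    if "k < i" "i \<le> length cs" for i k
    using up[OF color_adj.Row_Chain[OF that(2)], of k] down[OF color_adj.Row_Chain[OF that(2)], of k k] that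
    by auto
  \<comment> \<open>The row \<open>Row (Suc k)\<close> is the one whose last prime interval copies
    this interval.\<close>
  have chain: "(In Chain k, In Chain (Suc k)) \<in> \<theta> \<longleftrightarrow> cs ! k \<in> A" if "k < length cs" for k
    using row[of k "Suc k"] row_last[OF that] that by simp
  have pair: "(In (Link p q) 0, In (Link p q) (Suc 0)) \<in> \<theta> \<longleftrightarrow> q \<in> A"
    "(In (Link p q) 1, In (Link p q) 2) \<in> \<theta> \<longleftrightarrow> p \<in> A" "p \<in> A \<Longrightarrow> q \<in> A"
    if pq: "p \<in> set cs" "q \<in> set cs" "q \<sqsubset> p" for p q
  proof -
    note adj = color_adj.Color_Link1[OF pq] color_adj.Color_Link2[OF pq]
    have neq: "q \<noteq> p" using pq by (simp add: lless_eq)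
    show *: "(In (Link p q) 0, In (Link p q) (Suc 0)) \<in> \<theta> \<longleftrightarrow> q \<in> A"
      using up[OF adj(2), of 0] down[OF adj(2), of 0 0] neq color[OF pq(2)] by auto
    \<comment> \<open>The interval of \<open>Color p\<close> moves up to the whole
      \<open>Link\<close>; convexity splits it, and the lower half collapses \<open>Color q\<close>.
      Conversely the upper half alone moves down to \<open>Color p\<close>.\<close>
    have "(In (Link p q) 0, In (Link p q) 2) \<in> \<theta>" if "p \<in> A"
      using up[OF adj(1), of 0] color[OF pq(1)] that by simp
    moreover have "Link p q \<in> color_blocks" using adj_blocks[OF adj(1)] by simp
    ultimately have both: "(In (Link p q) 0, In (Link p q) 1) \<in> \<theta>" "(In (Link p q) 1, In (Link p q) 2) \<in> \<theta>"
      if "p \<in> A"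
      using steps_convex[OF \<theta>, of "Link p q" 0 2] that by (auto simp: numeral_2_eq_2)
    then show "(In (Link p q) 1, In (Link p q) 2) \<in> \<theta> \<longleftrightarrow> p \<in> A"
      using down[OF adj(1), of 0 1] color[OF pq(1)] by (auto simp: numeral_2_eq_2)
    show "p \<in> A \<Longrightarrow> q \<in> A" using both * by simp
  qed
  show "\<forall>p\<in>A. \<forall>q\<in>set cs. q \<sqsubseteq> p \<longrightarrow> q \<in> A"
  proof (intro ballI impI)
    fix p q assume "p \<in> A" "q \<in> set cs" "q \<sqsubseteq> p"
    then show "q \<in> A" using pair(3)[of p q] by (cases "q = p") (auto simp: lless_eq A_def)
  qed
  show "\<forall>b\<in>color_blocks. \<forall>k<color_len b. (In b k, In b (Suc k)) \<in> \<theta> \<longleftrightarrow> color_col b (Suc k) \<in> A"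
  proof (intro ballI allI impI)
    fix b k assume b: "b \<in> color_blocks" "k < color_len b"
    show "(In b k, In b (Suc k)) \<in> \<theta> \<longleftrightarrow> color_col b (Suc k) \<in> A"
    proof (cases b)
      case Chain
      then show ?thesis using chain[of k] b by simp
    next
      case (Row i)
      then have "i \<le> length cs" using b by (auto simp: color_blocks_def)
      then show ?thesis using row[of k i] chain[of k] b Row by simp
    next
      case (Tip i)
      then have "i < length cs" "cs ! i \<noteq> \<top>" "k = 0"
        using b by (auto simp: color_blocks_def split: if_splits)
      then show ?thesis using tip[of i] Tip by simp
    next
      case (Color p)
      then have "p \<in> set cs" "k = 0" using b by (auto simp: color_blocks_def)
      then show ?thesis using color[of p] Color by simp
    next
      case (Link p q)
      then have "p \<in> set cs" "q \<in> set cs" "q \<sqsubset> p" "k = 0 \<or> k = 1"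
        using b by (auto simp: color_blocks_def)
      then show ?thesis using pair(1,2)[of p q] Link by (auto simp: numeral_2_eq_2)
    next
      case (Iso i)
      then show ?thesis using b by simp
    qed
  qed
qed

sublocale representing_block_lattice D color_blocks color_len color_adj color_phi color_col
proof
  show "\<top> \<in> join_irreducibles D" using top_in_cs set_cs by simp
  show "color_col b (Suc k) \<in> join_irreducibles D" if "b \<in> color_blocks" "k < color_len b" for b k
    using color_col_irreducible[OF that] set_cs by simp
  show "\<exists>b\<in>color_blocks. \<exists>k<color_len b. color_col b (Suc k) = p" if "p \<in> join_irreducibles D" for p
    using that set_cs by (intro bexI[of _ "Color p"] exI[of _ 0]) (auto simp: color_blocks_def)
  fix \<theta> assume "lattice_congruence L \<theta>" "(Bot, Top) \<notin> \<theta>"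
  note steps = color_steps[OF this, unfolded set_cs]
  show "\<exists>A\<subseteq>join_irreducibles D. \<top> \<notin> A \<and>
      (\<forall>p\<in>A. \<forall>q\<in>join_irreducibles D. q \<sqsubseteq> p \<longrightarrow> q \<in> A) \<and>
      (\<forall>b\<in>color_blocks. \<forall>k<color_len b. (In b k, In b (Suc k)) \<in> \<theta> \<longleftrightarrow> color_col b (Suc k) \<in> A)"
    by (rule exI[of _ "{p \<in> join_irreducibles D. (In (Color p) 0, In (Color p) (Suc 0)) \<in> \<theta>}"],
        intro conjI steps) blast
qed

lemma sublist_singleton: "p \<in> set cs \<Longrightarrow> sublist [p] cs"
  by (auto simp: sublist_def in_set_conv_decomp)

text \<open>The auxiliary blocks add no new joins: intervals of a row are subwords of the word,
  \<open>Tip\<close> and \<open>Color\<close> give single letters, and a whole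
  \<open>Link p q\<close> gives \<open>p\<close> because \<open>q\<close> is below it. Conversely,
  every subword is an interval of \<open>Chain\<close>.\<close>

lemma block_sups:
  "{\<top>} \<union> {\<Squnion> (color_col b ` {k<..l}) |b k l. b \<in> color_blocks \<and> k \<le> l \<and> l \<le> color_len b}
    = {\<Squnion> (set l) |l. sublist l cs}"
proof (intro equalityI subsetI)
  have single: "p \<in> {\<Squnion> (set l) |l. sublist l cs}" if "p \<in> set cs" for p
    using sublist_singleton[OF that] sup_singleton[OF cs_carrier[OF that]]
    by (metis (mono_tags, lifting) list.set(1) list.simps(15) mem_Collect_eq)
  have empty: "\<Squnion> {} \<in> {\<Squnion> (set l) |l. sublist l cs}"
    using sublist_Nil_left[of cs] by (metis (mono_tags, lifting) list.set(1) mem_Collect_eq)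
  have segment: "\<Squnion> ((\<lambda>m. cs ! (m - 1)) ` {k<..l}) \<in> {\<Squnion> (set l) |l. sublist l cs}"
    if "k \<le> l" "l \<le> length cs" for k l
  proof -
    have "sublist (take (l - k) (drop k cs)) cs"
      using sublist_appendI[of "take (l - k) (drop k cs)" "take k cs" "drop (l - k) (drop k cs)"]
      by (simp only: append_take_drop_id)
    then show ?thesis unfolding sublist_image[OF that] by blast
  qed
  fix x
  assume "x \<in> {\<top>} \<union> {\<Squnion> (color_col b ` {k<..l}) |b k l. b \<in> color_blocks \<and> k \<le> l \<and> l \<le> color_len b}"
  then consider "x = \<top>" | b k l where "b \<in> color_blocks" "k \<le> l" "l \<le> color_len b"
    "x = \<Squnion> (color_col b ` {k<..l})" by blast
  then show "x \<in> {\<Squnion> (set l) |l. sublist l cs}"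
  proof cases
    \<comment> \<open>The full congruence is matched by the one-letter subword consisting of the
      unit.\<close>
    case 1 then show ?thesis using single top_in_cs by simp
  next
    case b: (2 b k l)
    have const: "x \<in> {\<Squnion> (set l) |l. sublist l cs}"
      if "\<And>m. 0 < m \<Longrightarrow> m \<le> color_len b \<Longrightarrow> color_col b m = p" "color_len b = 0 \<or> p \<in> set cs" for p
    proof (cases "k = l")
      case True then show ?thesis using empty b by simp
    next
      case False
      then have "{k<..l} \<noteq> {}" "\<forall>m\<in>{k<..l}. color_col b m = p" using that(1) b by auto
      then have "color_col b ` {k<..l} = {p}" by auto
      moreover have "p \<in> set cs" using that(2) b False by auto
      ultimately show ?thesis using single sup_singleton cs_carrier b by simp
    qed
    show ?thesis
    proof (cases b)
      case Chain
      then show ?thesis using segment[of k l] b by simp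
    next
      case (Row i)
      then have "l \<le> length cs" using b by (auto simp: color_blocks_def)
      then show ?thesis using segment[of k l] b Row by simp
    next
      case (Tip i)
      then show ?thesis using const[of "cs ! i"] b by (auto simp: color_blocks_def)
    next
      case (Color p)
      then show ?thesis using const[of p] b by (auto simp: color_blocks_def)
    next
      case (Iso i)
      then show ?thesis using const[of \<bottom>] b by (auto simp: color_blocks_def)
    next
      case (Link p q)
      then have pq: "p \<in> set cs" "q \<in> set cs" "q \<sqsubset> p"
        using b by (auto simp: color_blocks_def)
      have "\<Squnion> {p, q} = p"
        using pq join_absorb2[of q p] cs_carrier by (simp add: join_def lless_eq)
      moreover have "k = l \<or> k = 0 \<and> l = 1 \<or> k = 1 \<and> l = 2 \<or> k = 0 \<and> l = 2"
        using b Link by auto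
      moreover have "{0<..1} = {1::nat}" "{1<..2} = {2::nat}" "{0<..2} = {1, 2::nat}" by auto
      ultimately have "x = \<Squnion> {} \<or> x = q \<or> x = p"
        using b(4) Link sup_singleton[OF cs_carrier[OF pq(1)]] sup_singleton[OF cs_carrier[OF pq(2)]]
        by auto
      then show ?thesis
        by (elim disjE) (simp_all only: empty single[OF pq(1)] single[OF pq(2)])
    qed
  qed
next
  fix x assume "x \<in> {\<Squnion> (set l) |l. sublist l cs}"
  then obtain l ps ss where l: "x = \<Squnion> (set l)" "cs = ps @ l @ ss" by (auto simp: sublist_def)
  have "(\<lambda>m. cs ! (m - 1)) ` {length ps<..length ps + length l} = set l"
    using sublist_image[of "length ps" "length ps + length l" cs] l(2) by simp
  moreover have "color_col Chain = (\<lambda>m. cs ! (m - 1))" by (rule ext) simp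
  ultimately have "x = \<Squnion> (color_col Chain ` {length ps<..length ps + length l})"
    using l(1) by (simp only:)
  moreover have "Chain \<in> color_blocks" by (simp add: color_blocks_def)
  moreover have "length cs = length ps + length l + length ss" using l(2) by simp
  then have "length ps + length l \<le> color_len Chain" by simp
  ultimately show "x \<in> {\<top>} \<union>
      {\<Squnion> (color_col b ` {k<..l}) |b k l. b \<in> color_blocks \<and> k \<le> l \<and> l \<le> color_len b}"
    using le_add1 by blast
qed

lemma principal_congruence_representable:
  "principal_congruence_representable D {\<Squnion> (set l) |l. sublist l cs}"
  by (rule principal_congruence_representableI[OF L.finite_nonempty_lattice_axioms
      lattice_isomorphism_collapse]) (simp only: Princ_L block_sups)

end

theorem theorem3:
  fixes D :: "'a gorder" and Q :: "'a set"
  assumes "finite_distributive_lattice D"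
    and "\<top>\<^bsub>D\<^esub> \<in> join_irreducibles D"
    and "Q \<subseteq> carrier D"
  shows "principal_congruence_representable D Q \<longleftrightarrow> chain_representable D Q"
proof
  assume "principal_congruence_representable D Q"
  then obtain L :: "nat gorder" and \<phi> where L: "finite_nonempty_lattice L"
    and \<phi>: "lattice_isomorphism D (Con L) \<phi>" "\<phi> ` Q = Princ L"
    by (auto simp: principal_congruence_representable_def)
  then interpret representation D L \<phi>
    using assms(1) by (simp add: representation_def representation_axioms_def)
  show "chain_representable D Q" using chain_representable assms \<phi> by simp
next
  assume "chain_representable D Q"
  then obtain cs where cs: "set cs = join_irreducibles D" "Q = {\<Squnion>\<^bsub>D\<^esub> (set l) |l. sublist l cs}"
    by (auto simp: chain_representable_iff)
  interpret colored_word D cs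
    using assms cs by (simp add: colored_word_def colored_word_axioms_def)
  show "principal_congruence_representable D Q"
    unfolding cs(2) by (rule principal_congruence_representable)
qed

end
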